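(* Let $\mathcal{X}$ be a Banach space and let $C(K)$ denote the Banach space of continuous (complex-valued) functions on a nonempty compact Hausdorff space $K$, with the supremum norm. Then, for any two closed subspaces $\mathcal{Y}$ and $\mathcal{Z}$ of $\mathcal{X}$, $$d_{KK}(\mathcal{Y},\mathcal{Z}) = d_{KK}\left(\mathcal{Y}\otimes^{\varepsilon} C(K),\ \mathcal{Z}\otimes^{\varepsilon} C(K)\right)$$ and $$d_{0}(\mathcal{Y},\mathcal{Z}) = d_{0}\left(\mathcal{Y}\otimes^{\varepsilon} C(K),\ \mathcal{Z}\otimes^{\varepsilon} C(K)\right),$$ where the distances on the left are taken in $\mathcal{X}$ and those on the right are taken in $\mathcal{X}\otimes^{\varepsilon} C(K)$.
   Context: For a normed space $\mathcal{V}$, $B_1(\mathcal{V})$ denotes its closed unit ball, and for $v\in\mathcal{V}$, $S\subseteq\mathcal{V}$, $d(v,S)=\inf\{\|v-s\| : s\in S\}$. Kadison-Kastler distance: for subspaces $\mathcal{Y},\mathcal{Z}$ of a normed space $\mathcal{V}$, $$d_{KK}(\mathcal{Y},\mathcal{Z})=\max\left\{\sup_{y\in B_1(\mathcal{Y})} d(y,B_1(\mathcal{Z})),\ \sup_{z\in B_1(\mathcal{Z})} d(z,B_1(\mathcal{Y}))\right\}.$$ Christensen distance: for subspaces $\mathcal{Y},\mathcal{Z}$ of a normed space $\mathcal{V}$ and a scalar $\gamma>0$, write $\mathcal{Y}\subseteq_{\gamma}\mathcal{Z}$ if for each $y\in B_1(\mathcal{Y})$ there exists $z\in\mathcal{Z}$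 with $\|y-z\|\le\gamma$; and $$d_0(\mathcal{Y},\mathcal{Z})=\inf\{\gamma>0 : \mathcal{Y}\subseteq_{\gamma}\mathcal{Z}\text{ and }\mathcal{Z}\subseteq_{\gamma}\mathcal{Y}\}.$$ Injective tensor product: for Banach spaces $\mathcal{X},\mathcal{W}$, $\mathcal{X}\otimes^{\varepsilon}\mathcal{W}$ is the completion of the algebraic tensor product $\mathcal{X}\otimes\mathcal{W}$ in the norm $$\Big\|\sum_{i=1}^n x_i\otimes w_i\Big\|_{\varepsilon}=\sup\Big\{\Big|\sum_{i=1}^n\varphi(x_i)\psi(w_i)\Big| : \varphi\in B_1(\mathcal{X}^* ),\ \psi\in B_1(\mathcal{W}^* )\Big\}.$$ For a closed subspace $\mathcal{Y}\subseteq\mathcal{X}$, $\mathcal{Y}\otimes^{\varepsilon}\mathcal{W}$ is identified isometrically with the closure of $\mathcal{Y}\otimes\mathcal{W}$ in $\mathcal{X}\otimes^{\varepsilon}\mathcal{W}$. *)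

theory Defs
  imports "HOL-Analysis.Analysis" "HOL-Library.Poly_Mapping"
begin

section \<open>Complex normed spaces\<close>

class complex_vector = real_vector +
  fixes scaleC :: "complex \<Rightarrow> 'a \<Rightarrow> 'a" (infixr \<open>*\<^sub>C\<close> 75)
  assumes scaleC_add_right: "c *\<^sub>C (x + y) = c *\<^sub>C x + c *\<^sub>C y"
    and scaleC_add_left: "(c + d) *\<^sub>C x = c *\<^sub>C x + d *\<^sub>C x"
    and scaleC_scaleC: "c *\<^sub>C d *\<^sub>C x = (c * d) *\<^sub>C x"
    and scaleR_conv_scaleC: "r *\<^sub>R x = complex_of_real r *\<^sub>C x"

class complex_normed_vector = complex_vector + real_normed_vector +
  assumes norm_scaleC: "norm (c *\<^sub>C x) = cmod c * norm x"

class complex_banach = complex_normed_vector + banach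

lemma scaleC_one: "1 *\<^sub>C x = (x :: 'a :: complex_vector)"
  using scaleR_conv_scaleC[of 1 x] by simp

global_interpretation complex_vector: vector_space "scaleC :: complex \<Rightarrow> 'a \<Rightarrow> 'a :: complex_vector"
  defines csubspace = complex_vector.subspace
    and cspan = complex_vector.span
  by unfold_locales (simp_all add: scaleC_add_right scaleC_add_left scaleC_scaleC scaleC_one)

lemma bounded_linear_scaleC: "bounded_linear (\<lambda>x :: 'a :: complex_normed_vector. c *\<^sub>C x)"
  by (rule bounded_linear_intro[where K = "cmod c"])
    (auto simp: scaleC_add_right scaleR_conv_scaleC scaleC_scaleC norm_scaleC mult.commute)

instantiation complex :: complex_normed_vector
begin
definition scaleC_complex :: "complex \<Rightarrow> complex \<Rightarrow> complex" where
  "scaleC_complex c z = c * z"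
instance
  by standard (auto simp: scaleC_complex_def algebra_simps norm_mult scaleR_conv_of_real)
end

text \<open>
  For a compact space of type \<^typ>\<open>'k\<close>, boundedness is automatic, so \<^typ>\<open>'k \<Rightarrow>\<^sub>C complex\<close> with the
  supremum norm is $C(K)$.
\<close>

instantiation bcontfun :: (topological_space, complex_normed_vector) complex_normed_vector
begin

definition scaleC_bcontfun :: "complex \<Rightarrow> ('a \<Rightarrow>\<^sub>C 'b) \<Rightarrow> 'a \<Rightarrow>\<^sub>C 'b" where
  "scaleC_bcontfun c f = Bcontfun (\<lambda>x. c *\<^sub>C f x)"

lemma apply_scaleC_bcontfun [simp]: "apply_bcontfun (c *\<^sub>C f) x = c *\<^sub>C f x"
  for f :: "'a \<Rightarrow>\<^sub>C 'b"
proof -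
  have "continuous_on UNIV (\<lambda>x. c *\<^sub>C f x)"
    by (rule bounded_linear.continuous_on[OF bounded_linear_scaleC]) simp
  moreover have "norm (c *\<^sub>C f x) \<le> cmod c * norm f" for x
    by (simp add: norm_scaleC mult_left_mono norm_bounded)
  ultimately have "(\<lambda>x. c *\<^sub>C f x) \<in> bcontfun"
    by (rule bcontfun_normI)
  then show ?thesis
    by (simp add: scaleC_bcontfun_def Bcontfun_inverse)
qed

instance
proof
  fix c d :: complex and r :: real and f g :: "'a \<Rightarrow>\<^sub>C 'b"
  show "c *\<^sub>C (f + g) = c *\<^sub>C f + c *\<^sub>C g" "(c + d) *\<^sub>C f = c *\<^sub>C f + d *\<^sub>C f"
    "c *\<^sub>C d *\<^sub>C f = (c * d) *\<^sub>C f" "r *\<^sub>R f = complex_of_real r *\<^sub>C f"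
    by (auto intro!: bcontfun_eqI
        simp: scaleC_add_right scaleC_add_left scaleC_scaleC scaleR_conv_scaleC)
  have le: "norm (c *\<^sub>C f) \<le> cmod c * norm f" for c and f :: "'a \<Rightarrow>\<^sub>C 'b"
    by (rule norm_bound) (simp add: norm_scaleC mult_left_mono norm_bounded)
  show "norm (c *\<^sub>C f) = cmod c * norm f"
  proof (cases "c = 0")
    case True
    then show ?thesis using le[of 0 f] by simp
  next
    case False
    have "inverse c *\<^sub>C c *\<^sub>C f = f"
      using False by (auto intro!: bcontfun_eqI simp: scaleC_scaleC scaleC_one)
    then have "norm f \<le> norm (c *\<^sub>C f) / cmod c"
      using le[of "inverse c" "c *\<^sub>C f"] by (simp add: norm_inverse divide_inverse mult.commute)
    then show ?thesis
      using False le[of c f] by (simp add: field_simps)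
  qed
qed

end


section \<open>Dual space and the Hahn-Banach theorem\<close>

definition dual :: "('a :: complex_normed_vector \<Rightarrow> complex) set" where
  "dual = {\<phi>. bounded_linear \<phi> \<and> (\<forall>c x. \<phi> (c *\<^sub>C x) = c * \<phi> x)}"

definition dual_ball :: "('a :: complex_normed_vector \<Rightarrow> complex) set" where
  "dual_ball = {\<phi> \<in> dual. onorm \<phi> \<le> 1}"

lemma dual_ball_le: "\<phi> \<in> dual_ball \<Longrightarrow> cmod (\<phi> x) \<le> norm x"
  using onorm[of \<phi> x] mult_right_mono[of "onorm \<phi>" 1 "norm x"]
  by (fastforce simp: dual_ball_def dual_def)

lemma dual_ballI:
  assumes "\<And>x y. \<phi> (x + y) = \<phi> x + \<phi> y" "\<And>c x. \<phi> (c *\<^sub>C x) = c * \<phi> x"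
    "\<And>x. cmod (\<phi> x) \<le> norm x"
  shows "\<phi> \<in> dual_ball"
proof -
  have "bounded_linear \<phi>"
    by (rule bounded_linear_intro[where K = 1])
      (use assms in \<open>auto simp: scaleR_conv_scaleC scaleC_complex_def\<close>)
  moreover have "onorm \<phi> \<le> 1"
    by (rule onorm_bound) (use assms in auto)
  ultimately show ?thesis
    using assms by (auto simp: dual_ball_def dual_def)
qed

lemma dual_ball_add: "\<phi> \<in> dual_ball \<Longrightarrow> \<phi> (x + y) = \<phi> x + \<phi> y"
  and dual_ball_scaleC: "\<phi> \<in> dual_ball \<Longrightarrow> \<phi> (c *\<^sub>C x) = c * \<phi> x"
  by (auto simp: dual_ball_def dual_def linear_simps)

lemma dual_ball_zero: "\<phi> \<in> dual_ball \<Longrightarrow> \<phi> 0 = 0"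
  using dual_ball_le[of \<phi> 0] by simp

lemma dual_ball_sum: "\<phi> \<in> dual_ball \<Longrightarrow> \<phi> (\<Sum>i\<in>I. f i) = (\<Sum>i\<in>I. \<phi> (f i))"
  by (induction I rule: infinite_finite_induct) (auto simp: dual_ball_add dual_ball_zero)

lemma zero_in_dual_ball: "(\<lambda>_. 0) \<in> dual_ball"
  by (rule dual_ballI) auto

lemma dual_ball_nonempty [simp]: "dual_ball \<noteq> {}"
  using zero_in_dual_ball by blast

definition sublinear :: "('a :: real_normed_vector \<Rightarrow> real) \<Rightarrow> bool" where
  "sublinear p \<longleftrightarrow> (\<forall>x y. p (x + y) \<le> p x + p y) \<and>
     (\<forall>t x. 0 \<le> t \<longrightarrow> p (t *\<^sub>R x) = t * p x) \<and> (\<forall>x. p x \<le> norm x)"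

lemma sublinearD:
  assumes "sublinear p"
  shows "p (x + y) \<le> p x + p y" "0 \<le> t \<Longrightarrow> p (t *\<^sub>R x) = t * p x" "p x \<le> norm x"
    "- norm x \<le> p x" "p 0 = 0"
proof -
  show *: "p (x + y) \<le> p x + p y" "0 \<le> t \<Longrightarrow> p (t *\<^sub>R x) = t * p x" "p x \<le> norm x" for x y t
    using assms by (auto simp: sublinear_def)
  show z: "p 0 = 0"
    using *(2)[of 0 0] by simp
  show "- norm x \<le> p x"
    using *(1)[of x "- x"] *(3)[of "- x"] z by simp
qed

lemma sublinear_reduce:
  fixes x :: "'a :: real_normed_vector"
  assumes p: "sublinear p"
  obtains q where "sublinear q" "\<And>y. q y \<le> p y" "q (- x) \<le> - p x"
    "\<And>y. q y \<le> p (y + x) - p x"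
proof -
  define q where "q y = (INF t\<in>{0::real..}. p (y + t *\<^sub>R x) - t * p x)" for y
  have bd: "- norm y \<le> p (y + t *\<^sub>R x) - t * p x" if "0 \<le> t" for y t
  proof -
    have "t * p x \<le> p (y + t *\<^sub>R x) + p (- y)"
      using sublinearD(1)[OF p, of "y + t *\<^sub>R x" "- y"] sublinearD(2)[OF p that, of x] by simp
    then show ?thesis
      using sublinearD(3)[OF p, of "- y"] by simp
  qed
  have bdd: "bdd_below ((\<lambda>t. p (y + t *\<^sub>R x) - t * p x) ` {0..})" for y
    using bd by (intro bdd_belowI2[where m = "- norm y"]) auto
  have upper: "q y \<le> p (y + t *\<^sub>R x) - t * p x" if "0 \<le> t" for y t
    unfolding q_def using that by (intro cINF_lower bdd) auto
  have greatest: "m \<le> q y" if "\<And>t. 0 \<le> t \<Longrightarrow> m \<le> p (y + t *\<^sub>R x) - t * p x" for m y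
    unfolding q_def using that by (intro cINF_greatest) auto
  have qp: "q y \<le> p y" for y
    using upper[of 0 y] by simp
  have add: "q (y + z) \<le> q y + q z" for y z
  proof -
    have *: "q (y + z) \<le> (p (y + s *\<^sub>R x) - s * p x) + (p (z + t *\<^sub>R x) - t * p x)"
      if "0 \<le> s" "0 \<le> t" for s t
    proof -
      have "q (y + z) \<le> p ((y + z) + (s + t) *\<^sub>R x) - (s + t) * p x"
        using that by (intro upper) auto
      also have "(y + z) + (s + t) *\<^sub>R x = (y + s *\<^sub>R x) + (z + t *\<^sub>R x)"
        by (simp add: algebra_simps)
      also have "p \<dots> \<le> p (y + s *\<^sub>R x) + p (z + t *\<^sub>R x)"
        by (rule sublinearD(1)[OF p])
      finally show ?thesis by (simp add: algebra_simps)
    qed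
    have "q (y + z) - (p (y + s *\<^sub>R x) - s * p x) \<le> q z" if "0 \<le> s" for s
      using *[OF that] by (intro greatest) (simp add: algebra_simps)
    then have "q (y + z) - q z \<le> q y"
      by (intro greatest) (simp add: algebra_simps)
    then show ?thesis by simp
  qed
  have le: "q (r *\<^sub>R y) \<le> r * q y" if "0 < r" for r y
  proof -
    have "q (r *\<^sub>R y) / r \<le> p (y + t *\<^sub>R x) - t * p x" if "0 \<le> t" for t
    proof -
      have "q (r *\<^sub>R y) \<le> p (r *\<^sub>R y + (r * t) *\<^sub>R x) - (r * t) * p x"
        using that \<open>0 < r\<close> by (intro upper) auto
      also have "r *\<^sub>R y + (r * t) *\<^sub>R x = r *\<^sub>R (y + t *\<^sub>R x)"
        by (simp add: algebra_simps)
      also have "p \<dots> = r * p (y + t *\<^sub>R x)"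
        using \<open>0 < r\<close> by (intro sublinearD(2)[OF p]) auto
      finally show ?thesis
        using \<open>0 < r\<close> by (simp add: field_simps)
    qed
    then have "q (r *\<^sub>R y) / r \<le> q y" by (rule greatest)
    then show ?thesis using \<open>0 < r\<close> by (simp add: field_simps)
  qed
  have q0: "q 0 = 0"
    using qp[of 0] sublinearD(5)[OF p] bd[of _ 0] greatest[of 0 0] by fastforce
  have "q (r *\<^sub>R y) = r * q y" if "0 \<le> r" for r y
  proof (cases "r = 0")
    case True
    then show ?thesis using q0 by simp
  next
    case False
    then have "0 < r" using that by simp
    have "r * q (inverse r *\<^sub>R r *\<^sub>R y) \<le> r * (inverse r * q (r *\<^sub>R y))"
      using le[of "inverse r" "r *\<^sub>R y"] \<open>0 < r\<close> by (intro mult_left_mono) auto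
    then have "r * q y \<le> q (r *\<^sub>R y)"
      using \<open>0 < r\<close> by (simp add: field_simps)
    then show ?thesis using le[OF \<open>0 < r\<close>, of y] by simp
  qed
  then have "sublinear q"
    using add qp sublinearD(3)[OF p] unfolding sublinear_def by (meson order_trans)
  moreover have "q (- x) \<le> - p x"
    using upper[of 1 "- x"] sublinearD(5)[OF p] by simp
  moreover have "q y \<le> p (y + x) - p x" for y
    using upper[of 1 y] by simp
  ultimately show ?thesis
    using that qp by blast
qed

lemma sublinear_chain_Inf:
  fixes C :: "('a :: real_normed_vector \<Rightarrow> real) set"
  assumes ne: "C \<noteq> {}" and sub: "\<And>p. p \<in> C \<Longrightarrow> sublinear p"
    and chain: "\<And>p q. p \<in> C \<Longrightarrow> q \<in> C \<Longrightarrow> p \<le> q \<or> q \<le> p"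
  shows "sublinear (\<lambda>x. INF p\<in>C. p x)" and "\<And>p x. p \<in> C \<Longrightarrow> (INF p\<in>C. p x) \<le> p x"
proof -
  have bdd: "bdd_below ((\<lambda>p. p x) ` C)" for x
    using sublinearD(4)[OF sub] by (intro bdd_belowI2[where m = "- norm x"]) auto
  show low: "(INF p\<in>C. p x) \<le> p x" if "p \<in> C" for p x
    using that by (intro cINF_lower bdd)
  obtain p0 where p0: "p0 \<in> C" using ne by blast
  let ?u = "\<lambda>x. INF p\<in>C. p x"
  have add: "?u (x + y) \<le> ?u x + ?u y" for x y
  proof -
    have *: "?u (x + y) \<le> p x + q y" if "p \<in> C" "q \<in> C" for p q
    proof (cases "p \<le> q")
      case True
      then show ?thesis
        using low[OF that(1), of "x + y"] sublinearD(1)[OF sub[OF that(1)], of x y]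
          le_funD[OF True, of y] by simp
    next
      case False
      then have "q \<le> p" using chain that by blast
      then show ?thesis
        using low[OF that(2), of "x + y"] sublinearD(1)[OF sub[OF that(2)], of x y]
          le_funD[OF \<open>q \<le> p\<close>, of x] by simp
    qed
    have "?u (x + y) - p x \<le> q y" if "p \<in> C" "q \<in> C" for p q
      using *[OF that] by simp
    then have "?u (x + y) - p x \<le> ?u y" if "p \<in> C" for p
      using that by (intro cINF_greatest[OF ne]) auto
    then have "?u (x + y) - ?u y \<le> ?u x"
      by (intro cINF_greatest[OF ne]) (simp add: algebra_simps)
    then show ?thesis by simp
  qed
  have le: "?u (r *\<^sub>R x) \<le> r * ?u x" if "0 < r" for r x
  proof -
    have "?u (r *\<^sub>R x) / r \<le> p x" if "p \<in> C" for p
      using low[OF that, of "r *\<^sub>R x"] sublinearD(2)[OF sub[OF that], of r x] \<open>0 < r\<close>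
      by (simp add: field_simps)
    then have "?u (r *\<^sub>R x) / r \<le> ?u x"
      by (intro cINF_greatest[OF ne])
    then show ?thesis using that by (simp add: field_simps)
  qed
  have u0: "?u 0 = 0"
    using sublinearD(5)[OF sub] ne by (subst INF_cong[OF refl, where D = "\<lambda>_. 0"]) auto
  have "?u (r *\<^sub>R x) = r * ?u x" if "0 \<le> r" for r x
  proof (cases "r = 0")
    case True
    then show ?thesis using u0 by simp
  next
    case False
    then have "0 < r" using that by simp
    have "r * ?u (inverse r *\<^sub>R r *\<^sub>R x) \<le> r * (inverse r * ?u (r *\<^sub>R x))"
      using le[of "inverse r" "r *\<^sub>R x"] \<open>0 < r\<close> by (intro mult_left_mono) auto
    then have "r * ?u x \<le> ?u (r *\<^sub>R x)"
      using \<open>0 < r\<close> by (simp add: field_simps)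
    then show ?thesis using le[OF \<open>0 < r\<close>, of x] by simp
  qed
  moreover have "?u x \<le> norm x" for x
    using low[OF p0, of x] sublinearD(3)[OF sub[OF p0], of x] by simp
  ultimately show "sublinear ?u"
    using add unfolding sublinear_def by blast
qed

lemma real_norming_functional:
  fixes x :: "'a :: real_normed_vector"
  obtains f :: "'a \<Rightarrow> real"
  where "\<And>y z. f (y + z) = f y + f z" "\<And>r y. f (r *\<^sub>R y) = r * f y"
    "\<And>y. \<bar>f y\<bar> \<le> norm y" "f x = norm x"
proof -
  have "sublinear (norm :: 'a \<Rightarrow> real)"
    by (auto simp: sublinear_def norm_triangle_ineq)
  then obtain N where N: "sublinear N" "\<And>y. N y \<le> norm y" "N (- x) \<le> - norm x"
    using sublinear_reduce by metis
  define A where "A = {p. sublinear p \<and> p \<le> N}"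
  have "\<exists>m\<in>A. \<forall>a\<in>A. m \<ge> a \<longrightarrow> a = m"
  proof (rule predicate_Zorn)
    show "partial_order_on A (relation_of (\<ge>) A)"
      by (rule partial_order_on_relation_ofI) auto
    fix C assume C: "C \<in> Chains (relation_of (\<ge>) A)"
    show "\<exists>u\<in>A. \<forall>a\<in>C. a \<ge> u"
    proof (cases "C = {}")
      case True
      then show ?thesis using N(1) by (auto simp: A_def)
    next
      case False
      have CA: "C \<subseteq> A"
        using C by (auto simp: Chains_def relation_of_def)
      have ch: "p \<le> q \<or> q \<le> p" if "p \<in> C" "q \<in> C" for p q
        using C that by (auto simp: Chains_def relation_of_def)
      have sub: "sublinear p" if "p \<in> C" for p
        using CA that by (auto simp: A_def)
      have inf: "sublinear (\<lambda>x. INF p\<in>C. p x)" "\<And>p x. p \<in> C \<Longrightarrow> (INF p\<in>C. p x) \<le> p x"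
        using sublinear_chain_Inf[OF False] sub ch by blast+
      obtain p0 where p0: "p0 \<in> C" using False by blast
      have "(\<lambda>x. INF p\<in>C. p x) \<le> p0"
        using inf(2)[OF p0] by (auto simp: le_fun_def)
      then have "(\<lambda>x. INF p\<in>C. p x) \<in> A"
        using inf(1) CA p0 unfolding A_def by (blast intro: order_trans)
      then show ?thesis
        using inf(2) by (intro bexI[of _ "\<lambda>x. INF p\<in>C. p x"]) (auto simp: le_fun_def)
    qed
  qed
  then obtain f where f: "sublinear f" "f \<le> N" "\<And>q. sublinear q \<Longrightarrow> q \<le> f \<Longrightarrow> q = f"
    unfolding A_def by (auto intro: order_trans)
  have red: "f y \<le> f (y + z) - f z" "f (- z) \<le> - f z" for y z
  proof -
    obtain q where q: "sublinear q" "\<And>y. q y \<le> f y" "q (- z) \<le> - f z"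
      "\<And>y. q y \<le> f (y + z) - f z"
      using sublinear_reduce[OF f(1), of z] by blast
    have "q = f" using q f(3) by (auto simp: le_fun_def)
    then show "f y \<le> f (y + z) - f z" "f (- z) \<le> - f z" using q by auto
  qed
  have add: "f (y + z) = f y + f z" for y z
    using red(1)[of y z] sublinearD(1)[OF f(1), of y z] by simp
  have neg: "f (- z) = - f z" for z
    using add[of z "- z"] sublinearD(5)[OF f(1)] by simp
  have scale: "f (r *\<^sub>R y) = r * f y" for r y
  proof (cases "0 \<le> r")
    case True
    then show ?thesis by (rule sublinearD(2)[OF f(1)])
  next
    case False
    then have "f ((- r) *\<^sub>R y) = (- r) * f y" by (intro sublinearD(2)[OF f(1)]) simp
    then show ?thesis using neg[of "r *\<^sub>R y"] by simp
  qed
  have bd: "\<bar>f y\<bar> \<le> norm y" for y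
    using sublinearD(3,4)[OF f(1), of y] by (simp add: abs_le_iff)
  have "norm x \<le> f x"
    using le_funD[OF f(2), of "- x"] N(3) neg[of x] by simp
  then have "f x = norm x" using bd[of x] by simp
  then show ?thesis using that add scale bd by blast
qed

lemma norming_functional:
  fixes x :: "'a :: complex_normed_vector"
  obtains \<phi> where "\<phi> \<in> dual_ball" "\<phi> x = complex_of_real (norm x)"
proof -
  obtain f :: "'a \<Rightarrow> real" where f: "\<And>y z. f (y + z) = f y + f z"
    "\<And>r y. f (r *\<^sub>R y) = r * f y" "\<And>y. \<bar>f y\<bar> \<le> norm y" "f x = norm x"
    using real_norming_functional[of x] by blast
  define \<phi> where "\<phi> y = Complex (f y) (- f (\<i> *\<^sub>C y))" for y
  have Re: "Re (\<phi> y) = f y" for y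
    by (simp add: \<phi>_def)
  have add: "\<phi> (y + z) = \<phi> y + \<phi> z" for y z
    by (simp add: \<phi>_def f scaleC_add_right complex_eq_iff)
  have neg: "f (- y) = - f y" for y
    using f(2)[of "- 1" y] by simp
  have scale: "\<phi> (c *\<^sub>C y) = c * \<phi> y" for c y
  proof -
    have c: "c = of_real (Re c) + \<i> * of_real (Im c)"
      by (simp add: complex_eq_iff)
    have "c *\<^sub>C y = Re c *\<^sub>R y + Im c *\<^sub>R \<i> *\<^sub>C y"
      by (subst c) (simp add: scaleC_add_left scaleC_scaleC scaleR_conv_scaleC mult.commute)
    moreover have "\<i> *\<^sub>C c *\<^sub>C y = Re c *\<^sub>R \<i> *\<^sub>C y + Im c *\<^sub>R (- y)"
    proof -
      have "\<i> * c = of_real (Re c) * \<i> + of_real (Im c) * (- 1)"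
        by (simp add: complex_eq_iff)
      then have "\<i> *\<^sub>C c *\<^sub>C y = of_real (Re c) *\<^sub>C \<i> *\<^sub>C y + of_real (Im c) *\<^sub>C (- 1) *\<^sub>C y"
        unfolding scaleC_scaleC by (simp only: scaleC_add_left)
      also have "(- 1) *\<^sub>C y = - y"
        using complex_vector.scale_minus_left[of 1 y] by (simp only: scaleC_one)
      finally show ?thesis by (simp only: scaleR_conv_scaleC)
    qed
    ultimately have "f (c *\<^sub>C y) = Re c * f y + Im c * f (\<i> *\<^sub>C y)"
      "f (\<i> *\<^sub>C c *\<^sub>C y) = Re c * f (\<i> *\<^sub>C y) - Im c * f y"
      by (simp_all only: f neg)
    then show ?thesis
      by (simp add: \<phi>_def complex_eq_iff algebra_simps)
  qed
  have bd: "cmod (\<phi> y) \<le> norm y" for y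
  proof (cases "\<phi> y = 0")
    case False
    define c where "c = cnj (\<phi> y) / of_real (cmod (\<phi> y))"
    have "\<phi> (c *\<^sub>C y) = of_real (cmod (\<phi> y))"
      using False unfolding scale c_def
      by (simp add: complex_norm_square[symmetric] power2_eq_square mult.commute)
    then have "cmod (\<phi> y) = f (c *\<^sub>C y)"
      using Re[of "c *\<^sub>C y"] by simp
    also have "\<dots> \<le> norm (c *\<^sub>C y)"
      using f(3)[of "c *\<^sub>C y"] by simp
    also have "\<dots> = norm y"
      using False by (simp add: norm_scaleC c_def norm_divide)
    finally show ?thesis .
  qed simp
  have mem: "\<phi> \<in> dual_ball"
    by (rule dual_ballI) (use add scale bd in auto)
  have "(Re (\<phi> x))\<^sup>2 + (Im (\<phi> x))\<^sup>2 \<le> (norm x)\<^sup>2"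
    using power_mono[OF bd[of x], of 2] by (simp add: cmod_power2)
  then have "\<phi> x = complex_of_real (norm x)"
    using f(4) by (simp add: Re complex_eq_iff)
  then show ?thesis using that mem by blast
qed

lemma dual_ball_separates:
  fixes x :: "'a :: complex_normed_vector"
  assumes "\<And>\<phi>. \<phi> \<in> dual_ball \<Longrightarrow> \<phi> x = 0"
  shows "x = 0"
  using norming_functional[of x] assms by (metis norm_eq_zero of_real_eq_0_iff)


section \<open>The completion of a normed space\<close>

text \<open>Cauchy sequences modulo null sequences.\<close>

definition completion_rel :: "(nat \<Rightarrow> 'a :: real_normed_vector) \<Rightarrow> (nat \<Rightarrow> 'a) \<Rightarrow> bool" where
  "completion_rel X Y \<longleftrightarrow> Cauchy X \<and> Cauchy Y \<and> (\<lambda>n. X n - Y n) \<longlonglongrightarrow> 0"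

lemma part_equivp_completion_rel: "part_equivp (completion_rel :: (nat \<Rightarrow> 'a :: real_normed_vector) \<Rightarrow> _)"
proof (rule part_equivpI)
  have "Cauchy (\<lambda>_. 0 :: 'a)"
    by (simp add: convergent_Cauchy convergent_const)
  then show "\<exists>X :: nat \<Rightarrow> 'a. completion_rel X X"
    by (intro exI[of _ "\<lambda>_. 0"]) (simp add: completion_rel_def)
  show "symp (completion_rel :: (nat \<Rightarrow> 'a) \<Rightarrow> _)"
    unfolding symp_def completion_rel_def using tendsto_minus by fastforce
  show "transp (completion_rel :: (nat \<Rightarrow> 'a) \<Rightarrow> _)"
  proof (rule transpI)
    fix X Y Z :: "nat \<Rightarrow> 'a"
    assume "completion_rel X Y" "completion_rel Y Z"
    then show "completion_rel X Z"
      using tendsto_add[of "\<lambda>n. X n - Y n" 0 sequentially "\<lambda>n. Y n - Z n" 0]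
      by (simp add: completion_rel_def)
  qed
qed

quotient_type (overloaded) 'a completion = "nat \<Rightarrow> 'a :: real_normed_vector" / partial: completion_rel
  by (rule part_equivp_completion_rel)

lemma Cauchy_dominated:
  fixes X Y :: "nat \<Rightarrow> 'a :: real_normed_vector" and Z :: "nat \<Rightarrow> 'b :: real_normed_vector"
  assumes "Cauchy X" "Cauchy Y"
    and le: "\<And>m n. norm (Z m - Z n) \<le> norm (X m - X n) + norm (Y m - Y n)"
  shows "Cauchy Z"
proof (rule CauchyI)
  fix e :: real assume "0 < e"
  then have "0 < e / 2" by simp
  obtain M where M: "\<And>m n. M \<le> m \<Longrightarrow> M \<le> n \<Longrightarrow> norm (X m - X n) < e / 2"
    using CauchyD[OF assms(1) \<open>0 < e / 2\<close>] by blast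
  obtain N where N: "\<And>m n. N \<le> m \<Longrightarrow> N \<le> n \<Longrightarrow> norm (Y m - Y n) < e / 2"
    using CauchyD[OF assms(2) \<open>0 < e / 2\<close>] by blast
  have "norm (Z m - Z n) < e" if "max M N \<le> m" "max M N \<le> n" for m n
    using le[of m n] M[of m n] N[of m n] that by simp
  then show "\<exists>M. \<forall>m\<ge>M. \<forall>n\<ge>M. norm (Z m - Z n) < e"
    by blast
qed

lemma Cauchy_plus: "Cauchy X \<Longrightarrow> Cauchy Y \<Longrightarrow> Cauchy (\<lambda>n. X n + Y n)"
  for X Y :: "nat \<Rightarrow> 'a :: real_normed_vector"
  by (erule (1) Cauchy_dominated) (simp add: add_diff_add norm_triangle_ineq)

lemma Cauchy_minus: "Cauchy X \<Longrightarrow> Cauchy Y \<Longrightarrow> Cauchy (\<lambda>n. X n - Y n)"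
  for X Y :: "nat \<Rightarrow> 'a :: real_normed_vector"
proof (erule (1) Cauchy_dominated)
  show "norm (X m - Y m - (X n - Y n)) \<le> norm (X m - X n) + norm (Y m - Y n)" for m n
    using norm_triangle_ineq4[of "X m - X n" "Y m - Y n"] by (simp add: algebra_simps)
qed

lemma Cauchy_norm: "Cauchy X \<Longrightarrow> Cauchy (\<lambda>n. norm (X n))"
  for X :: "nat \<Rightarrow> 'a :: real_normed_vector"
proof (rule Cauchy_dominated[of X X])
  show "norm (norm (X m) - norm (X n)) \<le> norm (X m - X n) + norm (X m - X n)" for m n
    using norm_triangle_ineq3[of "X m" "X n"] norm_ge_zero[of "X m - X n"]
    unfolding real_norm_def by linarith
qed

instantiation completion :: (real_normed_vector) real_vector
begin

lift_definition zero_completion :: "'a completion" is "\<lambda>_. 0"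
  by (simp add: completion_rel_def convergent_Cauchy convergent_const)

lift_definition plus_completion :: "'a completion \<Rightarrow> 'a completion \<Rightarrow> 'a completion"
  is "\<lambda>X Y n. X n + Y n"
proof -
  fix X X' Y Y' :: "nat \<Rightarrow> 'a"
  assume "completion_rel X X'" "completion_rel Y Y'"
  then show "completion_rel (\<lambda>n. X n + Y n) (\<lambda>n. X' n + Y' n)"
    using tendsto_add[of "\<lambda>n. X n - X' n" 0 sequentially "\<lambda>n. Y n - Y' n" 0]
    by (simp add: completion_rel_def Cauchy_plus algebra_simps)
qed

lift_definition minus_completion :: "'a completion \<Rightarrow> 'a completion \<Rightarrow> 'a completion"
  is "\<lambda>X Y n. X n - Y n"
proof -
  fix X X' Y Y' :: "nat \<Rightarrow> 'a"
  assume "completion_rel X X'" "completion_rel Y Y'"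
  then show "completion_rel (\<lambda>n. X n - Y n) (\<lambda>n. X' n - Y' n)"
    using tendsto_diff[of "\<lambda>n. X n - X' n" 0 sequentially "\<lambda>n. Y n - Y' n" 0]
    by (simp add: completion_rel_def Cauchy_minus algebra_simps)
qed

definition uminus_completion :: "'a completion \<Rightarrow> 'a completion" where
  "uminus_completion T = 0 - T"

lift_definition scaleR_completion :: "real \<Rightarrow> 'a completion \<Rightarrow> 'a completion"
  is "\<lambda>r X n. r *\<^sub>R X n"
proof -
  fix r and X X' :: "nat \<Rightarrow> 'a"
  assume "completion_rel X X'"
  then show "completion_rel (\<lambda>n. r *\<^sub>R X n) (\<lambda>n. r *\<^sub>R X' n)"
    using tendsto_scaleR[OF tendsto_const[of r], of "\<lambda>n. X n - X' n" 0 sequentially]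
    by (simp add: completion_rel_def bounded_linear.Cauchy[OF bounded_linear_scaleR_right]
        scaleR_diff_right)
qed

lemma abs_completion_exhaust:
  obtains X where "Cauchy X" "T = abs_completion X"
proof -
  have "completion_rel (rep_completion T) (rep_completion T)"
    using Quotient_rep_reflp[OF Quotient_completion] .
  then show ?thesis
    using that[of "rep_completion T"] Quotient_abs_rep[OF Quotient_completion, of T]
    by (simp add: completion_rel_def)
qed

lemma abs_completion_simps:
  fixes X Y :: "nat \<Rightarrow> 'a"
  assumes "Cauchy X"
  shows "Cauchy Y \<Longrightarrow> abs_completion X + abs_completion Y = abs_completion (\<lambda>n. X n + Y n)"
    and "Cauchy Y \<Longrightarrow> abs_completion X - abs_completion Y = abs_completion (\<lambda>n. X n - Y n)"
    and "r *\<^sub>R abs_completion X = abs_completion (\<lambda>n. r *\<^sub>R X n)"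
    and "Cauchy Y \<Longrightarrow> abs_completion X = abs_completion Y \<longleftrightarrow> (\<lambda>n. X n - Y n) \<longlonglongrightarrow> 0"
proof -
  have X: "completion_rel X X"
    using assms by (simp add: completion_rel_def)
  show "r *\<^sub>R abs_completion X = abs_completion (\<lambda>n. r *\<^sub>R X n)"
    using X by (rule scaleR_completion.abs_eq)
  assume "Cauchy Y"
  then have Y: "completion_rel Y Y"
    by (simp add: completion_rel_def)
  show "abs_completion X + abs_completion Y = abs_completion (\<lambda>n. X n + Y n)"
    using X Y by (rule plus_completion.abs_eq)
  show "abs_completion X - abs_completion Y = abs_completion (\<lambda>n. X n - Y n)"
    using X Y by (rule minus_completion.abs_eq)
  show "abs_completion X = abs_completion Y \<longleftrightarrow> (\<lambda>n. X n - Y n) \<longlonglongrightarrow> 0"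
    using Quotient_rel_abs2 X Y Quotient_rel[OF Quotient_completion, of X Y]
    by (auto simp: completion_rel_def)
qed

lemma zero_completion_eq: "Cauchy (\<lambda>_. 0 :: 'a)" "0 = abs_completion (\<lambda>_. 0 :: 'a)"
  by (simp_all add: convergent_Cauchy convergent_const zero_completion_def)

lemma Cauchy_scaleR: "Cauchy X \<Longrightarrow> Cauchy (\<lambda>n. r *\<^sub>R X n)" for X :: "nat \<Rightarrow> 'a"
  by (rule bounded_linear.Cauchy[OF bounded_linear_scaleR_right])

lemma Cauchy_uminus: "Cauchy X \<Longrightarrow> Cauchy (\<lambda>n. - X n)" for X :: "nat \<Rightarrow> 'a"
  using Cauchy_scaleR[of X "- 1"] by simp

instance
proof
  fix S T U :: "'a completion" and r s :: real
  obtain X where X: "Cauchy X" "S = abs_completion X"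
    by (rule abs_completion_exhaust)
  obtain Y where Y: "Cauchy Y" "T = abs_completion Y"
    by (rule abs_completion_exhaust)
  obtain Z where Z: "Cauchy Z" "U = abs_completion Z"
    by (rule abs_completion_exhaust)
  have neg: "- abs_completion V = abs_completion (\<lambda>n. - V n)" if "Cauchy V" for V :: "nat \<Rightarrow> 'a"
    using abs_completion_simps(2)[OF zero_completion_eq(1) that]
    by (simp add: uminus_completion_def zero_completion_eq(2))
  note simps = X Y Z zero_completion_eq neg Cauchy_scaleR abs_completion_simps(1-3)
    Cauchy_plus Cauchy_minus Cauchy_uminus
  show "S + T + U = S + (T + U)" "S + T = T + S" "0 + S = S"
    by (simp_all add: simps ac_simps)
  show "S - T = S + - T" "- S + S = 0"
    by (simp_all add: simps)
  show "r *\<^sub>R (S + T) = r *\<^sub>R S + r *\<^sub>R T" "(r + s) *\<^sub>R S = r *\<^sub>R S + s *\<^sub>R S"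
    "r *\<^sub>R s *\<^sub>R S = (r * s) *\<^sub>R S" "1 *\<^sub>R S = S"
    by (simp_all add: simps scaleR_add_left scaleR_add_right)
qed

end

instantiation completion :: (real_normed_vector) real_normed_vector
begin

lift_definition norm_completion :: "'a completion \<Rightarrow> real" is "\<lambda>X. lim (\<lambda>n. norm (X n))"
proof -
  fix X X' :: "nat \<Rightarrow> 'a"
  assume X: "completion_rel X X'"
  then have "(\<lambda>n. norm (X n)) \<longlonglongrightarrow> lim (\<lambda>n. norm (X n))"
    using Cauchy_norm[of X] unfolding completion_rel_def
    by (simp add: Cauchy_convergent_iff convergent_LIMSEQ_iff)
  moreover have "(\<lambda>n. X n - X' n) \<longlonglongrightarrow> 0"
    using X by (simp add: completion_rel_def)
  then have "(\<lambda>n. norm (X n) - norm (X' n)) \<longlonglongrightarrow> 0"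
    by (rule tendsto_0_le[where K = 1]) (simp add: norm_triangle_ineq3)
  ultimately have "(\<lambda>n. norm (X n) - (norm (X n) - norm (X' n))) \<longlonglongrightarrow> lim (\<lambda>n. norm (X n)) - 0"
    by (rule tendsto_diff)
  then have "(\<lambda>n. norm (X' n)) \<longlonglongrightarrow> lim (\<lambda>n. norm (X n))"
    by simp
  then show "lim (\<lambda>n. norm (X n)) = lim (\<lambda>n. norm (X' n))"
    by (simp add: limI)
qed

definition dist_completion :: "'a completion \<Rightarrow> 'a completion \<Rightarrow> real" where
  "dist_completion S T = norm (S - T)"

definition sgn_completion :: "'a completion \<Rightarrow> 'a completion" where
  "sgn_completion T = T /\<^sub>R norm T"

definition uniformity_completion :: "('a completion \<times> 'a completion) filter" where
  "uniformity_completion = (INF e\<in>{0<..}. principal {(S, T). dist S T < e})"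

definition open_completion :: "'a completion set \<Rightarrow> bool" where
  "open_completion U \<longleftrightarrow>
     (\<forall>S\<in>U. \<forall>\<^sub>F (S', T) in uniformity. S' = S \<longrightarrow> T \<in> U)"

lemma completion_cases:
  obtains X where "Cauchy X" "T = abs_completion X" "(\<lambda>n. norm (X n)) \<longlonglongrightarrow> norm T"
proof -
  let ?X = "rep_completion T"
  have X: "completion_rel ?X ?X"
    using Quotient_rep_reflp[OF Quotient_completion] .
  then have "(\<lambda>n. norm (?X n)) \<longlonglongrightarrow> lim (\<lambda>n. norm (?X n))"
    using Cauchy_norm[of ?X] unfolding completion_rel_def
    by (simp add: Cauchy_convergent_iff convergent_LIMSEQ_iff)
  then show ?thesis
    using that[of ?X] X Quotient_abs_rep[OF Quotient_completion, of T]
    by (simp add: norm_completion_def completion_rel_def)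
qed

lemma norm_abs_completion:
  assumes "Cauchy X" shows "(\<lambda>n. norm (X n)) \<longlonglongrightarrow> norm (abs_completion X)"
proof -
  have "completion_rel X X"
    using assms by (simp add: completion_rel_def)
  then have "norm (abs_completion X) = lim (\<lambda>n. norm (X n))"
    by (rule norm_completion.abs_eq)
  then show ?thesis
    using Cauchy_norm[OF assms] by (simp add: Cauchy_convergent_iff convergent_LIMSEQ_iff)
qed

instance
proof
  fix S T :: "'a completion" and r :: real
  obtain X where X: "Cauchy X" "S = abs_completion X" "(\<lambda>n. norm (X n)) \<longlonglongrightarrow> norm S"
    by (rule completion_cases)
  obtain Y where Y: "Cauchy Y" "T = abs_completion Y" "(\<lambda>n. norm (Y n)) \<longlonglongrightarrow> norm T"
    by (rule completion_cases)
  have "(\<lambda>n. norm (X n + Y n)) \<longlonglongrightarrow> norm (S + T)"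
    using norm_abs_completion[OF Cauchy_plus[OF X(1) Y(1)]] X(1,2) Y(1,2)
    by (simp add: abs_completion_simps)
  then show "norm (S + T) \<le> norm S + norm T"
    using tendsto_add[OF X(3) Y(3)] by (rule LIMSEQ_le) (auto simp: norm_triangle_ineq)
  have "(\<lambda>n. norm (r *\<^sub>R X n)) \<longlonglongrightarrow> norm (r *\<^sub>R S)"
    using norm_abs_completion[OF Cauchy_scaleR[OF X(1), of r]] X(1,2)
    by (simp add: abs_completion_simps)
  moreover have "(\<lambda>n. norm (r *\<^sub>R X n)) \<longlonglongrightarrow> \<bar>r\<bar> * norm S"
    using tendsto_mult_left[OF X(3), of "\<bar>r\<bar>"] by simp
  ultimately show "norm (r *\<^sub>R S) = \<bar>r\<bar> * norm S"
    by (rule LIMSEQ_unique)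
  have "norm S = 0 \<longleftrightarrow> (\<lambda>n. norm (X n)) \<longlonglongrightarrow> 0"
    using X(3) LIMSEQ_unique by auto
  then show "norm S = 0 \<longleftrightarrow> S = 0"
    using abs_completion_simps(4)[OF X(1) zero_completion_eq(1)]
    by (simp add: X(2) zero_completion_eq(2) tendsto_norm_zero_iff)
qed (simp_all add: dist_completion_def sgn_completion_def uniformity_completion_def
    open_completion_def)

end

lift_definition of_completion :: "'a :: real_normed_vector \<Rightarrow> 'a completion" is "\<lambda>x _. x"
  by (simp add: completion_rel_def convergent_Cauchy convergent_const)

lemma of_completion_LIMSEQ:
  assumes "Cauchy X" shows "(\<lambda>n. of_completion (X n)) \<longlonglongrightarrow> abs_completion X"
proof (rule LIMSEQ_I)
  fix e :: real assume "e > 0"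
  then obtain N where N: "\<forall>m\<ge>N. \<forall>n\<ge>N. norm (X m - X n) < e / 2"
    using assms unfolding Cauchy_iff by (meson half_gt_zero)
  have "norm (of_completion (X n) - abs_completion X) < e" if "n \<ge> N" for n
  proof -
    have c: "Cauchy (\<lambda>_. X n)"
      by (simp add: convergent_Cauchy convergent_const)
    then have "of_completion (X n) - abs_completion X = abs_completion (\<lambda>m. X n - X m)"
      unfolding of_completion_def using assms by (simp add: abs_completion_simps)
    then have "(\<lambda>m. norm (X n - X m)) \<longlonglongrightarrow> norm (of_completion (X n) - abs_completion X)"
      using norm_abs_completion[OF Cauchy_minus[OF c assms]] by simp
    then have "norm (of_completion (X n) - abs_completion X) \<le> e / 2"
      using N that by (intro LIMSEQ_le_const2) (auto intro!: exI[of _ N] less_imp_le)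
    then show ?thesis using \<open>e > 0\<close> by simp
  qed
  then show "\<exists>N. \<forall>n\<ge>N. norm (of_completion (X n) - abs_completion X) < e"
    by blast
qed

lemma norm_of_completion [simp]: "norm (of_completion x) = norm x"
proof -
  have "Cauchy (\<lambda>_. x)"
    by (simp add: convergent_Cauchy convergent_const)
  then show ?thesis
    using norm_abs_completion[of "\<lambda>_. x"] by (simp add: of_completion_def LIMSEQ_const_iff)
qed

lemma of_completion_diff: "of_completion (x - y) = of_completion x - of_completion y"
  and of_completion_add: "of_completion (x + y) = of_completion x + of_completion y"
  by (transfer; simp add: completion_rel_def convergent_Cauchy convergent_const)+

lemma closure_range_of_completion: "closure (range of_completion) = UNIV"
proof -
  have "T \<in> closure (range of_completion)" for T :: "'a completion"
  proof -
    obtain X where X: "Cauchy X" "T = abs_completion X"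
      by (rule abs_completion_exhaust)
    then show ?thesis
      unfolding closure_sequential
      using of_completion_LIMSEQ[OF X(1)] by (intro exI[of _ "\<lambda>n. of_completion (X n)"]) simp
  qed
  then show ?thesis by blast
qed

instance completion :: (real_normed_vector) banach
proof
  fix T :: "nat \<Rightarrow> 'a completion"
  assume T: "Cauchy T"
  have "\<exists>x. dist (of_completion x) (T n) < inverse (Suc n)" for n
  proof -
    have "T n \<in> closure (range of_completion)"
      by (simp add: closure_range_of_completion)
    then show ?thesis
      unfolding closure_approachable by (auto dest: spec[of _ "inverse (Suc n)"])
  qed
  then obtain x where x: "\<And>n. dist (of_completion (x n)) (T n) < inverse (Suc n)"
    by metis
  have lim: "(\<lambda>n. of_completion (x n) - T n) \<longlonglongrightarrow> 0"
  proof (rule Lim_null_comparison)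
    show "\<forall>\<^sub>F n in sequentially. norm (of_completion (x n) - T n) \<le> inverse (real (Suc n))"
      using x by (simp add: dist_norm less_imp_le)
  qed (rule LIMSEQ_inverse_real_of_nat)
  have "Cauchy (\<lambda>n. (of_completion (x n) - T n) + T n)"
    by (rule Cauchy_plus[OF LIMSEQ_imp_Cauchy[OF lim] T])
  then have "Cauchy (\<lambda>n. of_completion (x n))"
    by simp
  then have "Cauchy x"
    unfolding Cauchy_iff by (simp flip: of_completion_diff)
  then have "(\<lambda>n. of_completion (x n)) \<longlonglongrightarrow> abs_completion x"
    by (rule of_completion_LIMSEQ)
  then have "(\<lambda>n. of_completion (x n) - (of_completion (x n) - T n)) \<longlonglongrightarrow> abs_completion x - 0"
    using lim by (rule tendsto_diff)
  then show "convergent T"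
    by (auto simp: convergent_def)
qed

instantiation completion :: (complex_normed_vector) complex_normed_vector
begin

lift_definition scaleC_completion :: "complex \<Rightarrow> 'a completion \<Rightarrow> 'a completion"
  is "\<lambda>c X n. c *\<^sub>C X n"
proof -
  fix c and X X' :: "nat \<Rightarrow> 'a"
  assume X: "completion_rel X X'"
  have "bounded_linear (\<lambda>x :: 'a. c *\<^sub>C x)"
    by (rule bounded_linear_scaleC)
  then show "completion_rel (\<lambda>n. c *\<^sub>C X n) (\<lambda>n. c *\<^sub>C X' n)"
    using X bounded_linear.tendsto[of "\<lambda>x. c *\<^sub>C x" "\<lambda>n. X n - X' n" 0 sequentially]
    by (simp add: completion_rel_def bounded_linear.Cauchy complex_vector.scale_right_diff_distrib)
qed

lemma scaleC_abs_completion: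
  "Cauchy X \<Longrightarrow> c *\<^sub>C abs_completion X = abs_completion (\<lambda>n. c *\<^sub>C X n)" for X :: "nat \<Rightarrow> 'a"
  by (rule scaleC_completion.abs_eq) (simp add: completion_rel_def)

instance
proof
  fix S T :: "'a completion" and c d :: complex and r :: real
  obtain X where X: "Cauchy X" "S = abs_completion X" "(\<lambda>n. norm (X n)) \<longlonglongrightarrow> norm S"
    by (rule completion_cases)
  obtain Y where Y: "Cauchy Y" "T = abs_completion Y" "(\<lambda>n. norm (Y n)) \<longlonglongrightarrow> norm T"
    by (rule completion_cases)
  have sc: "Cauchy (\<lambda>n. c *\<^sub>C V n)" if "Cauchy V" for c and V :: "nat \<Rightarrow> 'a"
    using that by (rule bounded_linear.Cauchy[OF bounded_linear_scaleC])
  note simps = X(1,2) Y(1,2) sc abs_completion_simps(1-3) scaleC_abs_completion Cauchy_plus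
  show "c *\<^sub>C (S + T) = c *\<^sub>C S + c *\<^sub>C T" "(c + d) *\<^sub>C S = c *\<^sub>C S + d *\<^sub>C S"
    "c *\<^sub>C d *\<^sub>C S = (c * d) *\<^sub>C S" "r *\<^sub>R S = complex_of_real r *\<^sub>C S"
    by (simp_all add: simps scaleC_add_right scaleC_add_left scaleC_scaleC
        scaleR_conv_scaleC[where 'a = 'a])
  have "(\<lambda>n. norm (c *\<^sub>C X n)) \<longlonglongrightarrow> norm (c *\<^sub>C S)"
    using norm_abs_completion[OF sc[OF X(1), of c]] X(1,2) by (simp add: scaleC_abs_completion)
  moreover have "(\<lambda>n. norm (c *\<^sub>C X n)) \<longlonglongrightarrow> cmod c * norm S"
    using tendsto_mult_left[OF X(3), of "cmod c"] by (simp add: norm_scaleC)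
  ultimately show "norm (c *\<^sub>C S) = cmod c * norm S"
    by (rule LIMSEQ_unique)
qed

end

instance completion :: (complex_normed_vector) complex_banach ..

lemma of_completion_scaleC: "of_completion (c *\<^sub>C x) = c *\<^sub>C of_completion x"
  by (simp add: of_completion_def scaleC_abs_completion convergent_Cauchy convergent_const)


section \<open>The algebraic tensor product\<close>

text \<open>
  Finitely supported functions \<^typ>\<open>'k \<Rightarrow>\<^sub>0 complex\<close> serve as the free complex vector space on \<^typ>\<open>'k\<close>.
\<close>

instantiation poly_mapping :: (type, complex_vector) complex_vector
begin

definition scaleC_poly_mapping :: "complex \<Rightarrow> ('a \<Rightarrow>\<^sub>0 'b) \<Rightarrow> 'a \<Rightarrow>\<^sub>0 'b" where
  "scaleC_poly_mapping c u = Poly_Mapping.map (\<lambda>z. c *\<^sub>C z) u"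

definition scaleR_poly_mapping :: "real \<Rightarrow> ('a \<Rightarrow>\<^sub>0 'b) \<Rightarrow> 'a \<Rightarrow>\<^sub>0 'b" where
  "scaleR_poly_mapping r u = complex_of_real r *\<^sub>C u"

lemma lookup_scaleC [simp]: "Poly_Mapping.lookup (c *\<^sub>C u) k = c *\<^sub>C Poly_Mapping.lookup u k" for u :: "'a \<Rightarrow>\<^sub>0 'b"
  by (simp add: scaleC_poly_mapping_def map.rep_eq when_def)

instance
  by standard (auto intro!: poly_mapping_eqI simp: scaleR_poly_mapping_def lookup_add
      scaleC_add_right scaleC_add_left scaleC_scaleC scaleC_one)

end

lemma scaleC_single: "c *\<^sub>C Poly_Mapping.single k z = Poly_Mapping.single k (c *\<^sub>C z)"
  by (rule poly_mapping_eqI) (simp add: lookup_single when_def)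

definition tensor_relations ::
    "('a :: complex_vector \<times> 'b :: complex_vector \<Rightarrow>\<^sub>0 complex) set" where
  "tensor_relations = (let e = (\<lambda>p. Poly_Mapping.single p 1) in
     {e (x + y, w) - e (x, w) - e (y, w) | x y w. True} \<union>
     {e (x, v + w) - e (x, v) - e (x, w) | x v w. True} \<union>
     {e (c *\<^sub>C x, w) - c *\<^sub>C e (x, w) | c x w. True} \<union>
     {e (x, c *\<^sub>C w) - c *\<^sub>C e (x, w) | c x w. True})"

definition tensor_rel ::
    "('a :: complex_vector \<times> 'b :: complex_vector \<Rightarrow>\<^sub>0 complex) \<Rightarrow> ('a \<times> 'b \<Rightarrow>\<^sub>0 complex) \<Rightarrow> bool" where
  "tensor_rel u v \<longleftrightarrow> u - v \<in> cspan tensor_relations"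

lemma equivp_tensor_rel:
  "equivp (tensor_rel :: ('a :: complex_vector \<times> 'b :: complex_vector \<Rightarrow>\<^sub>0 complex) \<Rightarrow> _)"
proof (rule equivpI)
  show "reflp (tensor_rel :: ('a \<times> 'b \<Rightarrow>\<^sub>0 complex) \<Rightarrow> _)"
    by (simp add: reflp_def tensor_rel_def complex_vector.span_zero)
  show "symp (tensor_rel :: ('a \<times> 'b \<Rightarrow>\<^sub>0 complex) \<Rightarrow> _)"
    unfolding symp_def tensor_rel_def by (auto dest: complex_vector.span_neg)
  show "transp (tensor_rel :: ('a \<times> 'b \<Rightarrow>\<^sub>0 complex) \<Rightarrow> _)"
    unfolding transp_def tensor_rel_def
  proof safe
    fix u v w :: "'a \<times> 'b \<Rightarrow>\<^sub>0 complex"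
    assume "u - v \<in> cspan tensor_relations" "v - w \<in> cspan tensor_relations"
    then have "(u - v) + (v - w) \<in> cspan tensor_relations"
      by (rule complex_vector.span_add)
    then show "u - w \<in> cspan tensor_relations" by simp
  qed
qed

quotient_type (overloaded) ('a, 'b) tensor =
    "'a :: complex_vector \<times> 'b :: complex_vector \<Rightarrow>\<^sub>0 complex" / tensor_rel
  by (rule equivp_tensor_rel)

instantiation tensor :: (complex_vector, complex_vector) complex_vector
begin

lift_definition zero_tensor :: "('a, 'b) tensor" is 0 .

lift_definition plus_tensor :: "('a, 'b) tensor \<Rightarrow> ('a, 'b) tensor \<Rightarrow> ('a, 'b) tensor" is "(+)"
  unfolding tensor_rel_def by (simp add: add_diff_add complex_vector.span_add)

lift_definition uminus_tensor :: "('a, 'b) tensor \<Rightarrow> ('a, 'b) tensor" is uminus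
  unfolding tensor_rel_def by (drule complex_vector.span_neg) simp

lift_definition minus_tensor :: "('a, 'b) tensor \<Rightarrow> ('a, 'b) tensor \<Rightarrow> ('a, 'b) tensor" is "(-)"
  unfolding tensor_rel_def
proof -
  fix u u' v v' :: "'a \<times> 'b \<Rightarrow>\<^sub>0 complex"
  assume "u - u' \<in> cspan tensor_relations" "v - v' \<in> cspan tensor_relations"
  then have "(u - u') - (v - v') \<in> cspan tensor_relations"
    by (rule complex_vector.span_diff)
  then show "(u - v) - (u' - v') \<in> cspan tensor_relations"
    by (simp add: algebra_simps)
qed

lift_definition scaleC_tensor :: "complex \<Rightarrow> ('a, 'b) tensor \<Rightarrow> ('a, 'b) tensor" is scaleC
  unfolding tensor_rel_def complex_vector.scale_right_diff_distrib[symmetric]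
  by (rule complex_vector.span_scale)

definition scaleR_tensor :: "real \<Rightarrow> ('a, 'b) tensor \<Rightarrow> ('a, 'b) tensor" where
  "scaleR_tensor r t = complex_of_real r *\<^sub>C t"

instance
proof
  fix s t u :: "('a, 'b) tensor" and c d :: complex and r q :: real
  have refl: "u = v \<Longrightarrow> tensor_rel u v" for u v :: "'a \<times> 'b \<Rightarrow>\<^sub>0 complex"
    using equivp_reflp[OF equivp_tensor_rel] by simp
  show "s + t + u = s + (t + u)" "s + t = t + s" "0 + s = s" "- s + s = 0" "s - t = s + - t"
    by (transfer; rule refl; simp add: ac_simps)+
  show C: "c *\<^sub>C (s + t) = c *\<^sub>C s + c *\<^sub>C t" "(c + d) *\<^sub>C s = c *\<^sub>C s + d *\<^sub>C s"
      "c *\<^sub>C d *\<^sub>C s = (c * d) *\<^sub>C s" for c d and s t :: "('a, 'b) tensor"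
    by (transfer; rule refl; simp add: scaleC_add_right scaleC_add_left scaleC_scaleC)+
  show "r *\<^sub>R s = complex_of_real r *\<^sub>C s"
    by (simp add: scaleR_tensor_def)
  show "r *\<^sub>R (s + t) = r *\<^sub>R s + r *\<^sub>R t" "(r + q) *\<^sub>R s = r *\<^sub>R s + q *\<^sub>R s"
      "r *\<^sub>R q *\<^sub>R s = (r * q) *\<^sub>R s"
    by (simp_all add: scaleR_tensor_def C)
  have "1 *\<^sub>C s = s"
    by (transfer; rule refl; simp add: scaleC_one)
  then show "1 *\<^sub>R s = s"
    by (simp add: scaleR_tensor_def)
qed

end

lift_definition tensor :: "'a :: complex_vector \<Rightarrow> 'b :: complex_vector \<Rightarrow> ('a, 'b) tensor"
    (infixr \<open>\<otimes>\<close> 76)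
  is "\<lambda>x w. Poly_Mapping.single (x, w) 1" .

lemma tensor_add_left: "(x + y) \<otimes> w = x \<otimes> w + y \<otimes> w"
  and tensor_add_right: "x \<otimes> (v + w) = x \<otimes> v + x \<otimes> w"
  and tensor_scaleC_left: "(c *\<^sub>C x) \<otimes> w = c *\<^sub>C x \<otimes> w"
  and tensor_scaleC_right: "x \<otimes> (c *\<^sub>C w) = c *\<^sub>C x \<otimes> w"
proof -
  have *: "tensor_rel u v" if "u - v \<in> tensor_relations"
    for u v :: "'a :: complex_vector \<times> 'b :: complex_vector \<Rightarrow>\<^sub>0 complex"
    using that by (simp add: tensor_rel_def complex_vector.span_base)
  show "(x + y) \<otimes> w = x \<otimes> w + y \<otimes> w" "x \<otimes> (v + w) = x \<otimes> v + x \<otimes> w"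
    "(c *\<^sub>C x) \<otimes> w = c *\<^sub>C x \<otimes> w" "x \<otimes> (c *\<^sub>C w) = c *\<^sub>C x \<otimes> w"
    by (transfer, rule *, unfold tensor_relations_def Let_def diff_diff_add[symmetric], blast)+
qed

lemma tensor_zero_left [simp]: "0 \<otimes> w = 0"
  using tensor_scaleC_left[of 0 0 w] by (simp add: complex_vector.scale_zero_left)

lemma tensor_zero_right [simp]: "x \<otimes> 0 = 0"
  using tensor_scaleC_right[of x 0 0] by (simp add: complex_vector.scale_zero_left)

lemma tensor_sum_left: "(\<Sum>i\<in>I. f i) \<otimes> w = (\<Sum>i\<in>I. f i \<otimes> w)"
  by (induction I rule: infinite_finite_induct) (auto simp: tensor_add_left)

lemma tensor_sum_right: "x \<otimes> (\<Sum>i\<in>I. f i) = (\<Sum>i\<in>I. x \<otimes> f i)"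
  by (induction I rule: infinite_finite_induct) (auto simp: tensor_add_right)

lemma abs_tensor_sum: "abs_tensor (\<Sum>i\<in>I. f i) = (\<Sum>i\<in>I. abs_tensor (f i))"
  by (induction I rule: infinite_finite_induct)
    (auto simp: zero_tensor_def simp flip: plus_tensor.abs_eq)

lemma poly_mapping_sum_singles: "u = (\<Sum>k\<in>Poly_Mapping.keys u. Poly_Mapping.single k (Poly_Mapping.lookup u k))"
  by (rule poly_mapping_eqI)
    (auto simp: lookup_sum lookup_single when_def sum.delta in_keys_iff)

lemma tensor_eq_sum:
  obtains x :: "'b :: complex_vector \<Rightarrow> 'a :: complex_vector" and B
  where "finite B" "complex_vector.independent B" "t = (\<Sum>b\<in>B. x b \<otimes> b)"
proof -
  obtain u where u: "t = abs_tensor u"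
    using Quotient_abs_rep[OF Quotient_tensor, of t] by metis
  let ?K = "Poly_Mapping.keys u"
  have single: "abs_tensor (Poly_Mapping.single (y, w) c) = (c *\<^sub>C y) \<otimes> w" for y :: 'a and w :: 'b and c
    unfolding tensor_scaleC_left
    by (simp add: tensor_def scaleC_tensor.abs_eq scaleC_single scaleC_complex_def)
  have t: "t = (\<Sum>p\<in>?K. (Poly_Mapping.lookup u p *\<^sub>C fst p) \<otimes> snd p)"
  proof -
    have "t = abs_tensor (\<Sum>p\<in>?K. Poly_Mapping.single (fst p, snd p) (Poly_Mapping.lookup u p))"
      unfolding prod.collapse by (subst poly_mapping_sum_singles[symmetric]) (rule u)
    then show ?thesis by (simp only: abs_tensor_sum single)
  qed
  obtain B where B: "B \<subseteq> snd ` ?K" "complex_vector.independent B" "snd ` ?K \<subseteq> cspan B"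
    using complex_vector.maximal_independent_subset[of "snd ` ?K"] by blast
  have fin: "finite B"
    using finite_subset[OF B(1)] by simp
  have "\<exists>r. snd p = (\<Sum>b\<in>B. r b *\<^sub>C b)" if "p \<in> ?K" for p
  proof -
    have "snd p \<in> range (\<lambda>r. \<Sum>b\<in>B. r b *\<^sub>C b)"
      unfolding complex_vector.span_finite[OF fin, symmetric] using B(3) that by blast
    then show ?thesis by blast
  qed
  then obtain r where r: "\<And>p. p \<in> ?K \<Longrightarrow> snd p = (\<Sum>b\<in>B. r p b *\<^sub>C b)"
    by metis
  have "(Poly_Mapping.lookup u p *\<^sub>C fst p) \<otimes> snd p =
      (\<Sum>b\<in>B. (r p b *\<^sub>C Poly_Mapping.lookup u p *\<^sub>C fst p) \<otimes> b)" if "p \<in> ?K" for p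
    by (subst r[OF that])
      (simp only: tensor_sum_right tensor_scaleC_right tensor_scaleC_left)
  then have "t = (\<Sum>p\<in>?K. \<Sum>b\<in>B. (r p b *\<^sub>C Poly_Mapping.lookup u p *\<^sub>C fst p) \<otimes> b)"
    unfolding t by (rule sum.cong[OF refl])
  also have "\<dots> = (\<Sum>b\<in>B. (\<Sum>p\<in>?K. r p b *\<^sub>C Poly_Mapping.lookup u p *\<^sub>C fst p) \<otimes> b)"
    unfolding tensor_sum_left by (rule sum.swap)
  finally show ?thesis
    by (rule that[OF fin B(2)])
qed


section \<open>The injective tensor product\<close>

definition tensor_pairing ::
    "('a \<Rightarrow> complex) \<Rightarrow> ('b \<Rightarrow> complex) \<Rightarrow> ('a \<times> 'b \<Rightarrow>\<^sub>0 complex) \<Rightarrow> complex" where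
  "tensor_pairing \<phi> \<psi> u = (\<Sum>p\<in>Poly_Mapping.keys u. Poly_Mapping.lookup u p * \<phi> (fst p) * \<psi> (snd p))"

lemma tensor_pairing_eq:
  "finite S \<Longrightarrow> Poly_Mapping.keys u \<subseteq> S \<Longrightarrow>
    tensor_pairing \<phi> \<psi> u = (\<Sum>p\<in>S. Poly_Mapping.lookup u p * \<phi> (fst p) * \<psi> (snd p))"
  unfolding tensor_pairing_def by (rule sum.mono_neutral_left) (auto simp: in_keys_iff)

lemma tensor_pairing_add: "tensor_pairing \<phi> \<psi> (u + v) = tensor_pairing \<phi> \<psi> u + tensor_pairing \<phi> \<psi> v"
  using keys_add[of u v]
  by (simp add: tensor_pairing_eq[of "Poly_Mapping.keys u \<union> Poly_Mapping.keys v"] lookup_add algebra_simps sum.distrib)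

lemma tensor_pairing_scaleC: "tensor_pairing \<phi> \<psi> (c *\<^sub>C u) = c * tensor_pairing \<phi> \<psi> u"
proof -
  have "Poly_Mapping.keys (c *\<^sub>C u) \<subseteq> Poly_Mapping.keys u"
    by (auto simp: in_keys_iff scaleC_complex_def)
  then show ?thesis
    by (simp add: tensor_pairing_eq[of "Poly_Mapping.keys u"] scaleC_complex_def sum_distrib_left mult.assoc)
qed

lemma tensor_pairing_diff: "tensor_pairing \<phi> \<psi> (u - v) = tensor_pairing \<phi> \<psi> u - tensor_pairing \<phi> \<psi> v"
  using tensor_pairing_add[of \<phi> \<psi> "u - v" v] by simp

lemma tensor_pairing_single [simp]:
  "tensor_pairing \<phi> \<psi> (Poly_Mapping.single (x, w) c) = c * \<phi> x * \<psi> w"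
  by (simp add: tensor_pairing_eq[of "{(x, w)}"])

lemma tensor_pairing_zero [simp]: "tensor_pairing \<phi> \<psi> 0 = 0"
  by (simp add: tensor_pairing_def)

lemma tensor_pairing_sum:
  "tensor_pairing \<phi> \<psi> (\<Sum>i\<in>I. f i) = (\<Sum>i\<in>I. tensor_pairing \<phi> \<psi> (f i))"
  by (induction I rule: infinite_finite_induct) (auto simp: tensor_pairing_add)

lemma tensor_pairing_cong:
  assumes "tensor_rel u v" "\<phi> \<in> dual_ball" "\<psi> \<in> dual_ball"
  shows "tensor_pairing \<phi> \<psi> u = tensor_pairing \<phi> \<psi> v"
proof -
  have "tensor_pairing \<phi> \<psi> (u - v) = 0"
    using assms(1)[unfolded tensor_rel_def]
  proof (induction rule: complex_vector.span_induct_alt)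
    case (step c x y)
    have "tensor_pairing \<phi> \<psi> x = 0"
      using step(1) unfolding tensor_relations_def Let_def
      by (elim UnE CollectE exE conjE; hypsubst_thin)
        (simp_all add: tensor_pairing_diff tensor_pairing_scaleC dual_ball_add[OF assms(2)]
          dual_ball_add[OF assms(3)] dual_ball_scaleC[OF assms(2)] dual_ball_scaleC[OF assms(3)]
          distrib_left distrib_right)
    then show ?case
      using step by (simp add: tensor_pairing_add tensor_pairing_scaleC)
  qed simp
  then show ?thesis by (simp add: tensor_pairing_diff)
qed

definition injective_seminorm ::
    "('a :: complex_normed_vector \<times> 'b :: complex_normed_vector \<Rightarrow>\<^sub>0 complex) \<Rightarrow> real" where
  "injective_seminorm u = (SUP (\<phi>, \<psi>) \<in> dual_ball \<times> dual_ball. cmod (tensor_pairing \<phi> \<psi> u))"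

lemma injective_seminorm_upper:
  assumes "\<phi> \<in> dual_ball" "\<psi> \<in> dual_ball"
  shows "cmod (tensor_pairing \<phi> \<psi> u) \<le> injective_seminorm u"
proof -
  have "cmod (tensor_pairing \<phi> \<psi> u) \<le> (\<Sum>p\<in>Poly_Mapping.keys u. cmod (Poly_Mapping.lookup u p) * norm (fst p) * norm (snd p))"
    if "\<phi> \<in> dual_ball" "\<psi> \<in> dual_ball" for \<phi> \<psi>
    unfolding tensor_pairing_def using that
    by (intro sum_norm_le) (auto simp: norm_mult intro!: mult_mono dual_ball_le)
  then have "bdd_above ((\<lambda>(\<phi>, \<psi>). cmod (tensor_pairing \<phi> \<psi> u)) ` (dual_ball \<times> dual_ball))"
    by (intro bdd_aboveI2) auto
  then show ?thesis
    using cSUP_upper[of "(\<phi>, \<psi>)" "dual_ball \<times> dual_ball" "\<lambda>(\<phi>, \<psi>). cmod (tensor_pairing \<phi> \<psi> u)"] assms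
    by (simp add: injective_seminorm_def)
qed

lemma injective_seminorm_least:
  assumes "\<And>\<phi> \<psi>. \<phi> \<in> dual_ball \<Longrightarrow> \<psi> \<in> dual_ball \<Longrightarrow> cmod (tensor_pairing \<phi> \<psi> u) \<le> C"
  shows "injective_seminorm u \<le> C"
  unfolding injective_seminorm_def
  by (rule cSUP_least) (use assms in auto)

instantiation tensor :: (complex_normed_vector, complex_normed_vector) complex_normed_vector
begin

lift_definition norm_tensor :: "('a, 'b) tensor \<Rightarrow> real" is injective_seminorm
  unfolding injective_seminorm_def
  by (intro SUP_cong refl) (auto dest: tensor_pairing_cong)

definition dist_tensor :: "('a, 'b) tensor \<Rightarrow> ('a, 'b) tensor \<Rightarrow> real" where
  "dist_tensor s t = norm (s - t)"

definition sgn_tensor :: "('a, 'b) tensor \<Rightarrow> ('a, 'b) tensor" where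
  "sgn_tensor t = t /\<^sub>R norm t"

definition uniformity_tensor :: "(('a, 'b) tensor \<times> ('a, 'b) tensor) filter" where
  "uniformity_tensor = (INF e\<in>{0<..}. principal {(s, t). dist s t < e})"

definition open_tensor :: "('a, 'b) tensor set \<Rightarrow> bool" where
  "open_tensor U \<longleftrightarrow> (\<forall>s\<in>U. \<forall>\<^sub>F (s', t) in uniformity. s' = s \<longrightarrow> t \<in> U)"

text \<open>The injective norm on the algebraic tensor product, as usually stated.\<close>

lemma norm_sum_tensor:
  fixes x :: "'i \<Rightarrow> 'a" and w :: "'i \<Rightarrow> 'b"
  shows "norm (\<Sum>i\<in>I. x i \<otimes> w i) =
    (SUP (\<phi>, \<psi>) \<in> dual_ball \<times> dual_ball. cmod (\<Sum>i\<in>I. \<phi> (x i) * \<psi> (w i)))"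
proof -
  have "(\<Sum>i\<in>I. x i \<otimes> w i) = abs_tensor (\<Sum>i\<in>I. Poly_Mapping.single (x i, w i) 1)"
    by (simp add: abs_tensor_sum tensor_def)
  then show ?thesis
    by (simp add: norm_tensor.abs_eq injective_seminorm_def tensor_pairing_sum)
qed

instance
proof
  fix s t :: "('a, 'b) tensor" and c :: complex and r :: real
  show "norm (s + t) \<le> norm s + norm t"
  proof transfer
    fix u v :: "'a \<times> 'b \<Rightarrow>\<^sub>0 complex"
    show "injective_seminorm (u + v) \<le> injective_seminorm u + injective_seminorm v"
      by (intro injective_seminorm_least)
        (auto simp: tensor_pairing_add intro!: norm_triangle_le add_mono injective_seminorm_upper)
  qed
  have le: "injective_seminorm (c *\<^sub>C u) \<le> cmod c * injective_seminorm u"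
    for c and u :: "'a \<times> 'b \<Rightarrow>\<^sub>0 complex"
    by (intro injective_seminorm_least)
      (auto simp: tensor_pairing_scaleC norm_mult intro!: mult_left_mono injective_seminorm_upper)
  show C: "norm (c *\<^sub>C t) = cmod c * norm t" for c
  proof transfer
    fix c and u :: "'a \<times> 'b \<Rightarrow>\<^sub>0 complex"
    show "injective_seminorm (c *\<^sub>C u) = cmod c * injective_seminorm u"
    proof (cases "c = 0")
      case True
      have "0 \<le> injective_seminorm (c *\<^sub>C u)"
        using injective_seminorm_upper[OF zero_in_dual_ball zero_in_dual_ball, of "c *\<^sub>C u"]
        by (rule order_trans[OF norm_ge_zero])
      then show ?thesis using True le[of c u] by simp
    next
      case False
      then have "inverse c *\<^sub>C c *\<^sub>C u = u"
        by (simp add: scaleC_scaleC scaleC_one)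
      then have "injective_seminorm u \<le> cmod (inverse c) * injective_seminorm (c *\<^sub>C u)"
        using le[of "inverse c" "c *\<^sub>C u"] by simp
      then have "cmod c * injective_seminorm u \<le> injective_seminorm (c *\<^sub>C u)"
        using False by (simp add: norm_inverse norm_divide field_simps)
      then show ?thesis using le[of c u] by simp
    qed
  qed
  show "norm (r *\<^sub>R t) = \<bar>r\<bar> * norm t"
    by (simp add: scaleR_conv_scaleC C)
  show "norm t = 0 \<longleftrightarrow> t = 0"
  proof
    assume "t = 0"
    then show "norm t = 0" using C[of 0] by (simp add: complex_vector.scale_zero_left)
  next
    assume t0: "norm t = 0"
    obtain x :: "'b \<Rightarrow> 'a" and B where B: "finite B" "complex_vector.independent B"
      and t: "t = (\<Sum>b\<in>B. x b \<otimes> b)"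
      by (rule tensor_eq_sum)
    define u where "u = (\<Sum>b\<in>B. Poly_Mapping.single (x b, b) (1 :: complex))"
    have "t = abs_tensor u"
      by (simp add: t u_def abs_tensor_sum tensor_def)
    then have u0: "injective_seminorm u = 0"
      using t0 by (simp add: norm_tensor.abs_eq)
    have "x b = 0" if "b \<in> B" for b
    proof (rule dual_ball_separates)
      fix \<phi> :: "'a \<Rightarrow> complex" assume \<phi>: "\<phi> \<in> dual_ball"
      have "(\<Sum>b\<in>B. \<phi> (x b) *\<^sub>C b) = 0"
      proof (rule dual_ball_separates)
        fix \<psi> :: "'b \<Rightarrow> complex" assume \<psi>: "\<psi> \<in> dual_ball"
        have "tensor_pairing \<phi> \<psi> u = 0"
          using injective_seminorm_upper[OF \<phi> \<psi>, of u] u0 by simp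
        then show "\<psi> (\<Sum>b\<in>B. \<phi> (x b) *\<^sub>C b) = 0"
          using \<psi> by (simp add: u_def tensor_pairing_sum dual_ball_sum dual_ball_scaleC)
      qed
      then show "\<phi> (x b) = 0"
        using complex_vector.independentD[OF B(2) B(1) order_refl, of "\<lambda>b. \<phi> (x b)" b] that
        by blast
    qed
    then show "t = 0" by (simp add: t)
  qed
qed (simp_all add: dist_tensor_def sgn_tensor_def uniformity_tensor_def open_tensor_def)

end

type_synonym ('a, 'b) injective_tensor = "('a, 'b) tensor completion"

text \<open>
  For subspaces \<open>Y\<close> and \<open>W\<close>, the set \<open>Y \<otimes>\<^sub>\<epsilon> W\<close> below is the closure of their algebraic tensor product
  in the injective tensor product of the two ambient spaces, the latter being the whole type
  (lemma \<open>injective_tensor_UNIV\<close>).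
\<close>

definition injective_tensor ::
    "'a :: complex_normed_vector set \<Rightarrow> 'b :: complex_normed_vector set \<Rightarrow> ('a, 'b) injective_tensor set"
    (infixr \<open>\<otimes>\<^sub>\<epsilon>\<close> 76) where
  "Y \<otimes>\<^sub>\<epsilon> W = closure (of_completion ` cspan {y \<otimes> w | y w. y \<in> Y \<and> w \<in> W})"

lemma injective_tensor_UNIV: "UNIV \<otimes>\<^sub>\<epsilon> UNIV = UNIV"
proof -
  have "t \<in> cspan {y \<otimes> w | y w. y \<in> UNIV \<and> w \<in> UNIV}" for t :: "('a, 'b) tensor"
  proof -
    obtain x :: "'b \<Rightarrow> 'a" and B where "t = (\<Sum>b\<in>B. x b \<otimes> b)"
      by (rule tensor_eq_sum)
    then show ?thesis
      by (simp only:) (rule complex_vector.span_sum, rule complex_vector.span_base, blast)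
  qed
  then have "cspan {y \<otimes> w | y w. y \<in> UNIV \<and> w \<in> UNIV} = (UNIV :: ('a, 'b) tensor set)"
    by blast
  then show ?thesis
    by (simp add: injective_tensor_def closure_range_of_completion)
qed


section \<open>Distances between subspaces\<close>

definition unit_ball :: "'a :: real_normed_vector set \<Rightarrow> 'a set" where
  "unit_ball Y = {y \<in> Y. norm y \<le> 1}"

text \<open>\<^const>\<open>infdist\<close> is the distance to a set; it agrees with the infimum for the nonempty sets at hand.\<close>

definition kadison_kastler_dist :: "'a :: real_normed_vector set \<Rightarrow> 'a set \<Rightarrow> real" where
  "kadison_kastler_dist Y Z =
     max (SUP y\<in>unit_ball Y. infdist y (unit_ball Z)) (SUP z\<in>unit_ball Z. infdist z (unit_ball Y))"

definition near_inclusion :: "'a :: real_normed_vector set \<Rightarrow> real \<Rightarrow> 'a set \<Rightarrow> bool" where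
  "near_inclusion Y \<gamma> Z \<longleftrightarrow> (\<forall>y\<in>unit_ball Y. \<exists>z\<in>Z. norm (y - z) \<le> \<gamma>)"

definition christensen_dist :: "'a :: real_normed_vector set \<Rightarrow> 'a set \<Rightarrow> real" where
  "christensen_dist Y Z = Inf {\<gamma>. 0 < \<gamma> \<and> near_inclusion Y \<gamma> Z \<and> near_inclusion Z \<gamma> Y}"

end

theory Submission
  imports Defs
begin

text \<open>
  Evaluation at the points of $K$ identifies the algebraic tensor product of $X$ and $C(K)$
  isometrically with a space of continuous functions from $K$ to $X$ under the supremum norm
  (\<open>norm_tensor_le_iff\<close>): testing a tensor against $\varphi \otimes \psi$ amounts to applying $\psi$ to
  the scalar function $k \mapsto \varphi(t(k))$, so point evaluations already norm the second
  factor. This makes both distances comparable pointwise.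

  Passing from tensors to vectors, $y \in Y$ is replaced by the constant function $y \otimes 1$; a
  tensor near it is evaluated at one point (\<open>approximate_vector_of_tensor\<close>). Passing from
  vectors to tensors, a function $f$ with values in the unit ball of $Y$ has compact range, so
  finitely many of its values $f(j)$ come within a small $\delta$ of all the others, and a continuous
  partition of unity $(p_j)$ glues chosen vectors $z_j$ near $f(j)$ to $\sum_j z_j \otimes p_j$
  (\<open>approximate_tensor_of_vectors\<close>). Convex combinations increase neither the
  distance to $f(k)$ nor the norm, so the construction respects unit balls as well as subspaces.

  Both arguments lose an arbitrarily small amount, for approximating elements of the completion by
  algebraic tensors. Since both distances are infima of the admissible constants
  (for the Kadison-Kastler distance this is \<open>kadison_kastler_dist_eq_Inf\<close>), the loss disappears
  in the limit.
\<close>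

section \<open>Tensors as vector-valued functions\<close>

lemma point_evaluation_in_dual_ball: "(\<lambda>w :: 'k :: topological_space \<Rightarrow>\<^sub>C complex. w k) \<in> dual_ball"
  by (rule dual_ballI) (auto simp: scaleC_complex_def norm_bounded)

definition raw_eval ::
    "'k \<Rightarrow> ('x :: complex_normed_vector \<times> ('k :: topological_space \<Rightarrow>\<^sub>C complex) \<Rightarrow>\<^sub>0 complex) \<Rightarrow> 'x" where
  "raw_eval k u =
    (\<Sum>p\<in>Poly_Mapping.keys u. (Poly_Mapping.lookup u p * apply_bcontfun (snd p) k) *\<^sub>C fst p)"

lemma dual_ball_raw_eval:
  "\<phi> \<in> dual_ball \<Longrightarrow> \<phi> (raw_eval k u) = tensor_pairing \<phi> (\<lambda>w. apply_bcontfun w k) u"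
  by (simp add: raw_eval_def tensor_pairing_def dual_ball_sum dual_ball_scaleC mult_ac)

lemma dual_ball_diff: "\<phi> \<in> dual_ball \<Longrightarrow> \<phi> (x - y) = \<phi> x - \<phi> y"
  using dual_ball_add[of \<phi> "x - y" y] by simp

lemma eq_if_dual_ball_eq:
  fixes x y :: "'a :: complex_normed_vector"
  assumes "\<And>\<phi>. \<phi> \<in> dual_ball \<Longrightarrow> \<phi> x = \<phi> y"
  shows "x = y"
  using dual_ball_separates[of "x - y"] assms by (simp add: dual_ball_diff)

text \<open>
  Every functional turns \<open>raw_eval k u\<close> into a pairing of \<open>u\<close> with \<open>\<phi>\<close> and a point evaluation. Such
  pairings depend only on the tensor that \<open>u\<close> represents and are linear in \<open>u\<close>, and functionals
  separate points; so the same holds for \<open>raw_eval\<close>.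
\<close>

lift_definition tensor_eval ::
    "'k \<Rightarrow> ('x :: complex_normed_vector, 'k :: topological_space \<Rightarrow>\<^sub>C complex) tensor \<Rightarrow> 'x"
  is raw_eval
  by (rule eq_if_dual_ball_eq)
    (simp add: dual_ball_raw_eval tensor_pairing_cong point_evaluation_in_dual_ball)

lemma tensor_eval_tensor: "tensor_eval k (x \<otimes> w) = w k *\<^sub>C x"
  by transfer (simp add: raw_eval_def)

lemma tensor_eval_add: "tensor_eval k (s + t) = tensor_eval k s + tensor_eval k t"
  by (transfer, rule eq_if_dual_ball_eq)
    (simp add: dual_ball_raw_eval dual_ball_add tensor_pairing_add)

lemma tensor_eval_scaleC: "tensor_eval k (c *\<^sub>C t) = c *\<^sub>C tensor_eval k t"
  by (transfer, rule eq_if_dual_ball_eq)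
    (simp add: dual_ball_raw_eval dual_ball_scaleC tensor_pairing_scaleC)

lemma tensor_eval_diff: "tensor_eval k (s - t) = tensor_eval k s - tensor_eval k t"
  using tensor_eval_add[of k "s - t" t] by simp

lemma tensor_eval_zero: "tensor_eval k 0 = 0"
  using tensor_eval_diff[of k 0 0] by simp

lemma tensor_eval_sum: "tensor_eval k (\<Sum>i\<in>I. f i) = (\<Sum>i\<in>I. tensor_eval k (f i))"
  by (induction I rule: infinite_finite_induct) (auto simp: tensor_eval_add tensor_eval_zero)

lemma continuous_on_tensor_eval: "continuous_on UNIV (\<lambda>k. tensor_eval k t)"
proof transfer
  fix u :: "'b \<times> ('a \<Rightarrow>\<^sub>C complex) \<Rightarrow>\<^sub>0 complex"
  have "bounded_linear (\<lambda>c. c *\<^sub>C x)" for x :: 'b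
    by (rule bounded_linear_intro[where K = "norm x"])
      (auto simp: scaleC_add_left scaleR_conv_scaleC scaleC_scaleC norm_scaleC scaleC_complex_def)
  then have "continuous_on UNIV (\<lambda>k. g k *\<^sub>C x)"
    if "continuous_on UNIV g" for g :: "'a \<Rightarrow> complex" and x :: 'b
    using that by (rule bounded_linear.continuous_on)
  then show "continuous_on UNIV (\<lambda>k. raw_eval k u)"
    unfolding raw_eval_def by (intro continuous_on_sum) (simp add: continuous_on_mult_left)
qed

text \<open>
  The injective norm is a supremum over all \<open>\<phi>\<close> and \<open>\<psi>\<close>; that it is a supremum over
  points reflects that \<open>\<psi>\<close> is bounded by the supremum norm of the scalar function it is applied to,
  and that point evaluations are among the admissible \<open>\<psi>\<close>.
\<close>

lemma norm_tensor_le_iff: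
  fixes t :: "('x :: complex_normed_vector, 'k :: topological_space \<Rightarrow>\<^sub>C complex) tensor"
  shows "norm t \<le> M \<longleftrightarrow> (\<forall>k. norm (tensor_eval k t) \<le> M)"
proof
  have "norm (tensor_eval k t) \<le> norm t" for k
  proof transfer
    fix k :: 'k and u :: "'x \<times> ('k \<Rightarrow>\<^sub>C complex) \<Rightarrow>\<^sub>0 complex"
    obtain \<phi> where \<phi>: "\<phi> \<in> dual_ball" "\<phi> (raw_eval k u) = complex_of_real (norm (raw_eval k u))"
      by (rule norming_functional)
    then have "norm (raw_eval k u) = cmod (tensor_pairing \<phi> (\<lambda>w. apply_bcontfun w k) u)"
      by (metis abs_norm_cancel dual_ball_raw_eval norm_of_real)
    then show "norm (raw_eval k u) \<le> injective_seminorm u"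
      using injective_seminorm_upper[OF \<phi>(1) point_evaluation_in_dual_ball] by simp
  qed
  then show "norm t \<le> M \<Longrightarrow> \<forall>k. norm (tensor_eval k t) \<le> M"
    using order_trans by blast
next
  assume "\<forall>k. norm (tensor_eval k t) \<le> M"
  then show "norm t \<le> M"
  proof (transfer fixing: M)
    fix u :: "'x \<times> ('k \<Rightarrow>\<^sub>C complex) \<Rightarrow>\<^sub>0 complex"
    assume M: "\<forall>k. norm (raw_eval k u) \<le> M"
    show "injective_seminorm u \<le> M"
    proof (rule injective_seminorm_least)
      fix \<phi> :: "'x \<Rightarrow> complex" and \<psi> :: "('k \<Rightarrow>\<^sub>C complex) \<Rightarrow> complex"
      assume \<phi>: "\<phi> \<in> dual_ball" and \<psi>: "\<psi> \<in> dual_ball"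
      define h where
        "h = (\<Sum>p\<in>Poly_Mapping.keys u. (Poly_Mapping.lookup u p * \<phi> (fst p)) *\<^sub>C snd p)"
      have sum_apply: "apply_bcontfun (\<Sum>i\<in>I. f i) k = (\<Sum>i\<in>I. apply_bcontfun (f i) k)"
        for I and f :: "('x \<times> ('k \<Rightarrow>\<^sub>C complex)) \<Rightarrow> 'k \<Rightarrow>\<^sub>C complex" and k
        by (induction I rule: infinite_finite_induct) auto
      have "apply_bcontfun h k = \<phi> (raw_eval k u)" for k
        using \<phi> by (simp add: dual_ball_raw_eval h_def sum_apply tensor_pairing_def scaleC_complex_def)
      then have "norm h \<le> M"
        using M dual_ball_le[OF \<phi>] by (intro norm_bound) (metis order_trans)
      moreover have "tensor_pairing \<phi> \<psi> u = \<psi> h"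
        using \<psi> by (simp add: tensor_pairing_def h_def dual_ball_sum dual_ball_scaleC)
      ultimately show "cmod (tensor_pairing \<phi> \<psi> u) \<le> M"
        using dual_ball_le[OF \<psi>, of h] by simp
    qed
  qed
qed

abbreviation elementary_tensors ::
    "'a :: complex_vector set \<Rightarrow> 'b :: complex_vector set \<Rightarrow> ('a, 'b) tensor set" where
  "elementary_tensors Y W \<equiv> {y \<otimes> w | y w. y \<in> Y \<and> w \<in> W}"

lemma tensor_eval_in_subspace:
  assumes "csubspace Y" "t \<in> cspan (elementary_tensors Y W)"
  shows "tensor_eval k t \<in> Y"
  using assms(2)
proof (induction rule: complex_vector.span_induct_alt)
  case base
  then show ?case
    using assms(1) by (simp add: tensor_eval_zero complex_vector.subspace_0)
next
  case (step c x y)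
  then show ?case
    using assms(1)
    by (auto simp: tensor_eval_add tensor_eval_scaleC tensor_eval_tensor
        intro!: complex_vector.subspace_add complex_vector.subspace_scale)
qed

lemma of_completion_in_injective_tensor:
  "t \<in> cspan (elementary_tensors Y W) \<Longrightarrow> of_completion t \<in> Y \<otimes>\<^sub>\<epsilon> W"
  unfolding injective_tensor_def by (rule subsetD[OF closure_subset]) blast

lemma zero_in_injective_tensor: "0 \<in> Y \<otimes>\<^sub>\<epsilon> W"
  for Y :: "'a :: complex_normed_vector set" and W :: "'b :: complex_normed_vector set"
proof -
  have "of_completion (0 :: ('a, 'b) tensor) = 0"
    using of_completion_diff[of "0 :: ('a, 'b) tensor" 0] by simp
  then show ?thesis
    using of_completion_in_injective_tensor[OF complex_vector.span_zero, of Y W] by simp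
qed

text \<open>
  Approximants may be taken no larger in norm, by shrinking any given approximant radially onto the
  ball of radius \<open>norm T\<close>. Hence unit balls of the completed tensor products can be approximated from
  within unit balls of the algebraic ones.
\<close>

lemma algebraic_approximation:
  assumes T: "T \<in> Y \<otimes>\<^sub>\<epsilon> W" and "0 < \<delta>"
  obtains t where "t \<in> cspan (elementary_tensors Y W)" "norm t \<le> norm T"
    "norm (T - of_completion t) < \<delta>"
proof -
  obtain s where s: "s \<in> cspan (elementary_tensors Y W)" "dist (of_completion s) T < \<delta> / 2"
    using T \<open>0 < \<delta>\<close> unfolding injective_tensor_def closure_approachable
    by (metis (no_types, lifting) half_gt_zero imageE)
  then have sT: "norm (T - of_completion s) < \<delta> / 2"
    by (simp add: dist_norm norm_minus_commute)
  show thesis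
  proof (cases "norm s \<le> norm T")
    case True
    then show thesis
      using that[OF s(1)] sT \<open>0 < \<delta>\<close> by simp
  next
    case False
    define r where "r = norm T / norm s"
    have r: "0 \<le> r" "r \<le> 1" "r * norm s = norm T"
      using False by (auto simp: r_def divide_simps)
    have "norm s - norm T \<le> norm (T - of_completion s)"
      using norm_triangle_ineq2[of "of_completion s" T] by (simp add: norm_minus_commute)
    moreover have "norm (of_completion s - of_completion (r *\<^sub>R s)) = norm s - norm T"
    proof -
      have "s - r *\<^sub>R s = (1 - r) *\<^sub>R s"
        by (simp add: algebra_simps)
      then have "norm (s - r *\<^sub>R s) = (1 - r) * norm s"
        using r by simp
      then show ?thesis
        using r(3) by (simp add: algebra_simps flip: of_completion_diff)
    qed
    ultimately have "norm (T - of_completion (r *\<^sub>R s)) < \<delta>"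
      using norm_triangle_ineq[of "T - of_completion s" "of_completion s - of_completion (r *\<^sub>R s)"] sT
      by simp
    moreover have "r *\<^sub>R s \<in> cspan (elementary_tensors Y W)"
      unfolding scaleR_conv_scaleC by (rule complex_vector.span_scale) (rule s)
    ultimately show thesis
      using that r by simp
  qed
qed


section \<open>Gluing by partitions of unity\<close>

text \<open>
  The partition of unity is pulled back from the range of \<open>f\<close>: the tent functions of radius \<open>\<delta>\<close>
  around finitely many values of \<open>f\<close>, normalised by their sum.
\<close>

lemma partition_of_unity_by_values:
  fixes f :: "'k :: topological_space \<Rightarrow> 'x :: metric_space"
  assumes comp: "compact (UNIV :: 'k set)" and f: "continuous_on UNIV f" and "0 < \<delta>"
  obtains J and p :: "'k \<Rightarrow> 'k \<Rightarrow> real" where "finite J" "\<And>j. continuous_on UNIV (p j)"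
    "\<And>j k. 0 \<le> p j k" "\<And>k. (\<Sum>j\<in>J. p j k) = 1" "\<And>j k. p j k \<noteq> 0 \<Longrightarrow> dist (f k) (f j) < \<delta>"
proof -
  define U where "U j = {k. dist (f k) (f j) < \<delta>}" for j
  have U: "open (U j)" for j
    unfolding U_def by (intro open_Collect_less continuous_on_dist f continuous_on_const)
  have "k \<in> U k" for k
    using \<open>0 < \<delta>\<close> by (simp add: U_def)
  then have "UNIV \<subseteq> (\<Union>j. U j)"
    by blast
  then obtain J where J: "finite J" "UNIV \<subseteq> (\<Union>j\<in>J. U j)"
    by (rule compactE_image[OF comp U])
  define h where "h j k = max 0 (\<delta> - dist (f k) (f j))" for j k
  define H where "H k = (\<Sum>j\<in>J. h j k)" for k
  have h0: "0 \<le> h j k" for j k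
    by (simp add: h_def)
  have H: "0 < H k" for k
  proof -
    have "k \<in> (\<Union>j\<in>J. U j)"
      using J(2) by blast
    then obtain j where "j \<in> J" "k \<in> U j"
      by (rule UN_E)
    then have "j \<in> J" "0 < h j k"
      by (simp_all add: h_def U_def)
    then show ?thesis
      unfolding H_def by (rule sum_pos2[OF J(1)]) (rule h0)
  qed
  have hc: "continuous_on UNIV (h j)" for j
    unfolding h_def
    by (intro continuous_on_max continuous_on_diff continuous_on_dist continuous_on_const f)
  have "continuous_on UNIV H"
    unfolding H_def by (intro continuous_on_sum hc)
  then have "continuous_on UNIV (\<lambda>k. h j k / H k)" for j
    using H by (intro continuous_on_divide hc) (auto simp: less_le)
  moreover have "0 \<le> h j k / H k" for j k
    using h0 H by (simp add: less_imp_le)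
  moreover have "(\<Sum>j\<in>J. h j k / H k) = 1" for k
    using H[of k] by (simp add: H_def flip: sum_divide_distrib)
  moreover have "dist (f k) (f j) < \<delta>" if "h j k / H k \<noteq> 0" for j k
    using that by (auto simp: h_def max_def split: if_splits)
  ultimately show thesis
    by (rule that[OF J(1)])
qed

text \<open>
  The set \<open>S\<close> of permitted approximants is kept apart from the subspace \<open>Z\<close> so that one construction
  serves both distances: \<open>S = Z\<close> for Christensen's, and the unit ball of \<open>Z\<close> for that of Kadison and
  Kastler, where the last conclusion puts \<open>G\<close> into a unit ball again.
\<close>

lemma approximate_tensor_of_vectors:
  fixes Y Z S :: "'x :: complex_normed_vector set"
    and T :: "('x, 'k :: topological_space \<Rightarrow>\<^sub>C complex) injective_tensor"
  assumes comp: "compact (UNIV :: 'k set)" and Y: "csubspace Y"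
    and near: "near_inclusion Y \<gamma> S" and S: "S \<subseteq> Z"
    and T: "T \<in> unit_ball (Y \<otimes>\<^sub>\<epsilon> UNIV)" and "0 < \<delta>"
  obtains G where "G \<in> Z \<otimes>\<^sub>\<epsilon> UNIV" "norm (T - G) \<le> \<gamma> + \<delta>"
    "\<And>r. (\<And>z. z \<in> S \<Longrightarrow> norm z \<le> r) \<Longrightarrow> norm G \<le> r"
proof -
  have "0 < \<delta> / 2"
    using \<open>0 < \<delta>\<close> by simp
  obtain t where t: "t \<in> cspan (elementary_tensors Y UNIV)" "norm t \<le> norm T"
    "norm (T - of_completion t) < \<delta> / 2"
    using T \<open>0 < \<delta> / 2\<close> algebraic_approximation[of T Y UNIV "\<delta> / 2"]
    unfolding unit_ball_def by blast
  have "norm t \<le> 1"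
    using t(2) T by (simp add: unit_ball_def)
  then have ball: "tensor_eval j t \<in> unit_ball Y" for j
    using tensor_eval_in_subspace[OF Y t(1)] norm_tensor_le_iff[of t 1] by (auto simp: unit_ball_def)
  have "\<exists>z. z \<in> S \<and> norm (tensor_eval j t - z) \<le> \<gamma>" for j
    using near ball by (auto simp: near_inclusion_def)
  then obtain z where z: "\<And>j. z j \<in> S" "\<And>j. norm (tensor_eval j t - z j) \<le> \<gamma>"
    by metis
  obtain J and p :: "'k \<Rightarrow> 'k \<Rightarrow> real" where J: "finite J"
    and p: "\<And>j. continuous_on UNIV (p j)" "\<And>j k. 0 \<le> p j k" "\<And>k. (\<Sum>j\<in>J. p j k) = 1"
      "\<And>j k. p j k \<noteq> 0 \<Longrightarrow> dist (tensor_eval k t) (tensor_eval j t) < \<delta> / 2"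
    using partition_of_unity_by_values[OF comp continuous_on_tensor_eval[of t] \<open>0 < \<delta> / 2\<close>] by blast
  define P where "P j = Bcontfun (\<lambda>k. complex_of_real (p j k))" for j
  have P: "apply_bcontfun (P j) k = complex_of_real (p j k)" if "j \<in> J" for j k
  proof -
    have "p j k \<le> 1" for k
      using member_le_sum[of j J "\<lambda>j. p j k"] that J p by simp
    then have "(\<lambda>k. complex_of_real (p j k)) \<in> bcontfun"
      using p by (intro bcontfun_normI[of _ 1]) (auto intro!: continuous_intros)
    then show ?thesis
      by (simp add: P_def Bcontfun_inverse)
  qed
  define g where "g = (\<Sum>j\<in>J. z j \<otimes> P j)"
  have eval_g: "tensor_eval k g = (\<Sum>j\<in>J. p j k *\<^sub>R z j)" for k
    by (simp add: g_def tensor_eval_sum tensor_eval_tensor P scaleR_conv_scaleC)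
  \<comment> \<open>Only indices with positive weight at \<open>k\<close> count: for the others \<open>z j\<close> may be far from the
    value of \<open>t\<close> at \<open>k\<close>.\<close>
  have convex_bound: "norm (\<Sum>j\<in>J. p j k *\<^sub>R v j) \<le> r"
    if "\<And>j. p j k \<noteq> 0 \<Longrightarrow> norm (v j) \<le> r" for k r and v :: "'k \<Rightarrow> 'x"
  proof -
    have "norm (\<Sum>j\<in>J. p j k *\<^sub>R v j) \<le> (\<Sum>j\<in>J. p j k * r)"
    proof (rule sum_norm_le)
      fix j
      show "norm (p j k *\<^sub>R v j) \<le> p j k * r"
        using that[of j] p(2)[of j k] by (cases "p j k = 0") (auto intro: mult_left_mono)
    qed
    then show ?thesis
      by (simp add: p(3) flip: sum_distrib_right)
  qed
  have "norm (t - g) \<le> \<gamma> + \<delta> / 2"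
    unfolding norm_tensor_le_iff
  proof
    fix k
    have "tensor_eval k t = (\<Sum>j\<in>J. p j k *\<^sub>R tensor_eval k t)"
      by (simp add: p(3) flip: scaleR_sum_left)
    then have "tensor_eval k (t - g) = (\<Sum>j\<in>J. p j k *\<^sub>R (tensor_eval k t - z j))"
      by (simp add: tensor_eval_diff eval_g scaleR_diff_right sum_subtractf)
    also have "norm \<dots> \<le> \<gamma> + \<delta> / 2"
    proof (rule convex_bound)
      fix j assume "p j k \<noteq> 0"
      then have "norm (tensor_eval k t - tensor_eval j t) < \<delta> / 2"
        using p(4) by (simp add: dist_norm)
      then show "norm (tensor_eval k t - z j) \<le> \<gamma> + \<delta> / 2"
        using norm_triangle_ineq[of "tensor_eval k t - tensor_eval j t" "tensor_eval j t - z j"] z(2)[of j]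
        by simp
    qed
    finally show "norm (tensor_eval k (t - g)) \<le> \<gamma> + \<delta> / 2" .
  qed
  then have "norm (of_completion t - of_completion g) \<le> \<gamma> + \<delta> / 2"
    by (simp flip: of_completion_diff)
  then have "norm (T - of_completion g) \<le> \<gamma> + \<delta>"
    using t(3) norm_triangle_ineq[of "T - of_completion t" "of_completion t - of_completion g"] by simp
  moreover have "g \<in> cspan (elementary_tensors Z UNIV)"
    unfolding g_def using z(1) S
    by (intro complex_vector.span_sum complex_vector.span_base) blast
  then have "of_completion g \<in> Z \<otimes>\<^sub>\<epsilon> UNIV"
    by (rule of_completion_in_injective_tensor)
  moreover have "norm (of_completion g) \<le> r" if "\<And>z. z \<in> S \<Longrightarrow> norm z \<le> r" for r
    using that z(1) by (simp add: norm_tensor_le_iff eval_g convex_bound)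
  ultimately show thesis
    using that by blast
qed

text \<open>Evaluation at a point is a contraction that maps \<open>y \<otimes> 1\<close> to \<open>y\<close>.\<close>

lemma approximate_vector_of_tensor:
  fixes Z :: "'x :: complex_normed_vector set"
    and G :: "('x, 'k :: topological_space \<Rightarrow>\<^sub>C complex) injective_tensor"
  assumes Z: "csubspace Z" and G: "G \<in> Z \<otimes>\<^sub>\<epsilon> UNIV" and "0 < \<delta>"
  obtains z where "z \<in> Z" "norm z \<le> norm G"
    "norm (y - z) \<le> norm (of_completion (y \<otimes> const_bcontfun 1) - G) + \<delta>"
proof -
  obtain g where g: "g \<in> cspan (elementary_tensors Z UNIV)" "norm g \<le> norm G"
    "norm (G - of_completion g) < \<delta>"
    using algebraic_approximation[OF G \<open>0 < \<delta>\<close>] by blast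
  let ?y = "y \<otimes> const_bcontfun 1 :: ('x, 'k \<Rightarrow>\<^sub>C complex) tensor"
  \<comment> \<open>\<open>undefined\<close> serves as an arbitrary point of the space, which is nonempty as a type.\<close>
  define z where "z = tensor_eval undefined g"
  have "y - z = tensor_eval undefined (?y - g)"
    by (simp add: z_def tensor_eval_diff tensor_eval_tensor scaleC_one)
  then have "norm (y - z) \<le> norm (of_completion ?y - of_completion g)"
    using norm_tensor_le_iff[of "?y - g" "norm (?y - g)"] by (simp flip: of_completion_diff)
  also have "\<dots> \<le> norm (of_completion ?y - G) + norm (G - of_completion g)"
    using norm_triangle_ineq[of "of_completion ?y - G" "G - of_completion g"] by simp
  finally have "norm (y - z) \<le> norm (of_completion ?y - G) + \<delta>"
    using g(3) by simp
  moreover have "norm z \<le> norm G"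
    using g(2) norm_tensor_le_iff[of g "norm G"] by (simp add: z_def)
  moreover have "z \<in> Z"
    unfolding z_def by (rule tensor_eval_in_subspace[OF Z g(1)])
  ultimately show thesis
    using that by blast
qed


section \<open>Transfer of near inclusions\<close>

lemma constant_tensor_in_unit_ball:
  assumes "y \<in> unit_ball Y"
  shows "of_completion (y \<otimes> const_bcontfun 1) \<in>
    unit_ball (Y \<otimes>\<^sub>\<epsilon> (UNIV :: ('k :: topological_space \<Rightarrow>\<^sub>C complex) set))"
proof -
  have "y \<otimes> const_bcontfun 1 \<in> cspan (elementary_tensors Y (UNIV :: ('k \<Rightarrow>\<^sub>C complex) set))"
    using assms by (intro complex_vector.span_base) (auto simp: unit_ball_def)
  then show ?thesis
    using assms
    by (auto simp: unit_ball_def of_completion_in_injective_tensor norm_tensor_le_iff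
        tensor_eval_tensor scaleC_one)
qed

lemma near_inclusion_tensor:
  fixes Y Z :: "'x :: complex_normed_vector set"
  assumes "compact (UNIV :: 'k :: topological_space set)" "csubspace Y" "0 < \<delta>"
  shows "near_inclusion Y \<gamma> Z \<Longrightarrow>
      near_inclusion (Y \<otimes>\<^sub>\<epsilon> (UNIV :: ('k \<Rightarrow>\<^sub>C complex) set)) (\<gamma> + \<delta>) (Z \<otimes>\<^sub>\<epsilon> UNIV)"
    and "near_inclusion Y \<gamma> (unit_ball Z) \<Longrightarrow>
      near_inclusion (Y \<otimes>\<^sub>\<epsilon> (UNIV :: ('k \<Rightarrow>\<^sub>C complex) set)) (\<gamma> + \<delta>) (unit_ball (Z \<otimes>\<^sub>\<epsilon> UNIV))"
proof -
  show "near_inclusion (Y \<otimes>\<^sub>\<epsilon> (UNIV :: ('k \<Rightarrow>\<^sub>C complex) set)) (\<gamma> + \<delta>) (Z \<otimes>\<^sub>\<epsilon> UNIV)"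
    if near: "near_inclusion Y \<gamma> Z"
    unfolding near_inclusion_def[of "_ \<otimes>\<^sub>\<epsilon> _"]
  proof
    fix T :: "('x, 'k \<Rightarrow>\<^sub>C complex) injective_tensor"
    assume T: "T \<in> unit_ball (Y \<otimes>\<^sub>\<epsilon> UNIV)"
    show "\<exists>G\<in>Z \<otimes>\<^sub>\<epsilon> UNIV. norm (T - G) \<le> \<gamma> + \<delta>"
      by (rule approximate_tensor_of_vectors[OF assms(1,2) near order_refl T assms(3)]) blast
  qed
  show "near_inclusion (Y \<otimes>\<^sub>\<epsilon> (UNIV :: ('k \<Rightarrow>\<^sub>C complex) set)) (\<gamma> + \<delta>) (unit_ball (Z \<otimes>\<^sub>\<epsilon> UNIV))"
    if near: "near_inclusion Y \<gamma> (unit_ball Z)"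
    unfolding near_inclusion_def[of "_ \<otimes>\<^sub>\<epsilon> _"]
  proof
    fix T :: "('x, 'k \<Rightarrow>\<^sub>C complex) injective_tensor"
    assume T: "T \<in> unit_ball (Y \<otimes>\<^sub>\<epsilon> UNIV)"
    have sub: "unit_ball Z \<subseteq> Z" and le: "\<And>z. z \<in> unit_ball Z \<Longrightarrow> norm z \<le> 1"
      by (auto simp: unit_ball_def)
    obtain G where "G \<in> Z \<otimes>\<^sub>\<epsilon> UNIV" "norm (T - G) \<le> \<gamma> + \<delta>" "norm G \<le> 1"
      using approximate_tensor_of_vectors[OF assms(1,2) near sub T assms(3)] le by blast
    then show "\<exists>G\<in>unit_ball (Z \<otimes>\<^sub>\<epsilon> UNIV). norm (T - G) \<le> \<gamma> + \<delta>"
      by (auto simp: unit_ball_def)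
  qed
qed

lemma near_inclusion_of_tensor:
  fixes Y Z :: "'x :: complex_normed_vector set"
  assumes "csubspace Z" "0 < \<delta>"
  shows "near_inclusion (Y \<otimes>\<^sub>\<epsilon> (UNIV :: ('k :: topological_space \<Rightarrow>\<^sub>C complex) set)) \<gamma> (Z \<otimes>\<^sub>\<epsilon> UNIV) \<Longrightarrow>
      near_inclusion Y (\<gamma> + \<delta>) Z"
    and "near_inclusion (Y \<otimes>\<^sub>\<epsilon> (UNIV :: ('k \<Rightarrow>\<^sub>C complex) set)) \<gamma> (unit_ball (Z \<otimes>\<^sub>\<epsilon> UNIV)) \<Longrightarrow>
      near_inclusion Y (\<gamma> + \<delta>) (unit_ball Z)"
proof -
  have approx: "\<exists>z\<in>Z. norm z \<le> norm G \<and> norm (y - z) \<le> \<gamma> + \<delta>"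
    if "G \<in> Z \<otimes>\<^sub>\<epsilon> UNIV" "norm (of_completion (y \<otimes> const_bcontfun 1) - G) \<le> \<gamma>"
    for y and G :: "('x, 'k \<Rightarrow>\<^sub>C complex) injective_tensor"
  proof -
    obtain z where "z \<in> Z" "norm z \<le> norm G"
      "norm (y - z) \<le> norm (of_completion (y \<otimes> const_bcontfun 1) - G) + \<delta>"
      using approximate_vector_of_tensor[OF assms(1) \<open>G \<in> Z \<otimes>\<^sub>\<epsilon> UNIV\<close> assms(2)] by blast
    then show ?thesis
      using \<open>norm (_ - G) \<le> \<gamma>\<close> by (intro bexI[of _ z]) auto
  qed
  let ?c = "\<lambda>y. of_completion (y \<otimes> const_bcontfun 1) :: ('x, 'k \<Rightarrow>\<^sub>C complex) injective_tensor"
  show "near_inclusion Y (\<gamma> + \<delta>) Z"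
    if near: "near_inclusion (Y \<otimes>\<^sub>\<epsilon> (UNIV :: ('k \<Rightarrow>\<^sub>C complex) set)) \<gamma> (Z \<otimes>\<^sub>\<epsilon> UNIV)"
    unfolding near_inclusion_def
  proof
    fix y assume "y \<in> unit_ball Y"
    then obtain G where "G \<in> Z \<otimes>\<^sub>\<epsilon> UNIV" "norm (?c y - G) \<le> \<gamma>"
      using near constant_tensor_in_unit_ball unfolding near_inclusion_def by blast
    then show "\<exists>z\<in>Z. norm (y - z) \<le> \<gamma> + \<delta>"
      using approx by blast
  qed
  show "near_inclusion Y (\<gamma> + \<delta>) (unit_ball Z)"
    if near: "near_inclusion (Y \<otimes>\<^sub>\<epsilon> (UNIV :: ('k \<Rightarrow>\<^sub>C complex) set)) \<gamma> (unit_ball (Z \<otimes>\<^sub>\<epsilon> UNIV))"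
    unfolding near_inclusion_def
  proof
    fix y assume "y \<in> unit_ball Y"
    then obtain G where "G \<in> unit_ball (Z \<otimes>\<^sub>\<epsilon> UNIV)" "norm (?c y - G) \<le> \<gamma>"
      using near constant_tensor_in_unit_ball unfolding near_inclusion_def by blast
    then show "\<exists>z\<in>unit_ball Z. norm (y - z) \<le> \<gamma> + \<delta>"
      using approx[of G y] by (auto simp: unit_ball_def)
  qed
qed


section \<open>Distances as infima\<close>

lemma near_inclusion_one: "0 \<in> S \<Longrightarrow> near_inclusion Y 1 S"
  unfolding near_inclusion_def by (auto simp: unit_ball_def intro!: bexI[of _ 0])

lemma SUP_infdist_le:
  assumes "near_inclusion Y \<gamma> S" "0 \<in> Y"
  shows "(SUP y\<in>unit_ball Y. infdist y S) \<le> \<gamma>"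
proof (rule cSUP_least)
  show "unit_ball Y \<noteq> {}"
    using assms(2) by (auto simp: unit_ball_def intro!: exI[of _ 0])
  fix y assume "y \<in> unit_ball Y"
  then obtain z where "z \<in> S" "norm (y - z) \<le> \<gamma>"
    using assms(1) by (auto simp: near_inclusion_def)
  then show "infdist y S \<le> \<gamma>"
    by (intro infdist_le2[of z]) (auto simp: dist_norm)
qed

lemma infdist_le_SUP:
  assumes "0 \<in> S" "y \<in> unit_ball Y"
  shows "infdist y S \<le> (SUP y\<in>unit_ball Y. infdist y S)"
proof (rule cSUP_upper[OF assms(2)])
  have "infdist y S \<le> 1" if "y \<in> unit_ball Y" for y
    using infdist_le2[OF assms(1), of y 1] that by (simp add: unit_ball_def)
  then show "bdd_above ((\<lambda>y. infdist y S) ` unit_ball Y)"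
    by (rule bdd_aboveI2)
qed

text \<open>
  The distance to a set need not be attained, so \<open>SUP y\<in>unit_ball Y. infdist y S\<close> itself need not be
  admissible as \<open>\<gamma>\<close>; every larger number is.
\<close>

lemma near_inclusion_if_SUP_infdist_less:
  assumes "(SUP y\<in>unit_ball Y. infdist y S) < \<gamma>" "0 \<in> S"
  shows "near_inclusion Y \<gamma> S"
  unfolding near_inclusion_def
proof
  fix y assume "y \<in> unit_ball Y"
  then have "infdist y S < \<gamma>"
    using infdist_le_SUP[OF assms(2)] assms(1) by (blast intro: le_less_trans)
  then have "(INF z\<in>S. dist y z) < \<gamma>" "S \<noteq> {}"
    using assms(2) by (auto simp: infdist_def split: if_splits)
  then have "\<exists>z\<in>S. dist y z < \<gamma>"
    by (subst (asm) cINF_less_iff) auto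
  then show "\<exists>z\<in>S. norm (y - z) \<le> \<gamma>"
    by (auto simp: dist_norm intro: less_imp_le)
qed

lemma kadison_kastler_dist_eq_Inf:
  assumes "0 \<in> Y" "0 \<in> Z"
  shows "kadison_kastler_dist Y Z =
    Inf {\<gamma>. 0 < \<gamma> \<and> near_inclusion Y \<gamma> (unit_ball Z) \<and> near_inclusion Z \<gamma> (unit_ball Y)}"
    (is "_ = Inf ?A")
proof (rule antisym)
  have ball: "0 \<in> unit_ball Y" "0 \<in> unit_ball Z"
    using assms by (auto simp: unit_ball_def)
  then have "1 \<in> ?A"
    by (simp add: near_inclusion_one)
  then show "kadison_kastler_dist Y Z \<le> Inf ?A"
    unfolding kadison_kastler_dist_def using assms
    by (intro cInf_greatest) (auto intro: SUP_infdist_le)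
  have "0 \<le> kadison_kastler_dist Y Z"
    using infdist_le_SUP[OF ball(2,1)] infdist_nonneg[of 0 "unit_ball Z"]
    unfolding kadison_kastler_dist_def by linarith
  then have "\<gamma> \<in> ?A" if "kadison_kastler_dist Y Z < \<gamma>" for \<gamma>
    using that ball unfolding kadison_kastler_dist_def
    by (auto intro: near_inclusion_if_SUP_infdist_less)
  moreover have "bdd_below ?A"
    by (rule bdd_belowI[of _ 0]) auto
  ultimately have "Inf ?A \<le> \<gamma>" if "kadison_kastler_dist Y Z < \<gamma>" for \<gamma>
    using that by (intro cInf_lower) auto
  then show "Inf ?A \<le> kadison_kastler_dist Y Z"
    by (rule dense_ge)
qed

lemma Inf_le_if_shifts_subset:
  fixes A B :: "real set"
  assumes "A \<noteq> {}" "bdd_below B" "\<And>a \<delta>. a \<in> A \<Longrightarrow> 0 < \<delta> \<Longrightarrow> a + \<delta> \<in> B"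
  shows "Inf B \<le> Inf A"
proof (rule cInf_greatest[OF assms(1)])
  fix a assume "a \<in> A"
  then have "Inf B \<le> a + \<delta>" if "0 < \<delta>" for \<delta>
    using that assms by (intro cInf_lower) auto
  then show "Inf B \<le> a"
    by (rule field_le_epsilon)
qed

text \<open>
  The admissible constants for the subspaces and for their tensor products need not form the same
  set, but they agree up to arbitrarily small positive shifts.
\<close>

lemma Inf_eq_if_shifts_subset:
  fixes A B :: "real set"
  assumes "A \<noteq> {}" "\<And>a. a \<in> A \<Longrightarrow> 0 < a" "\<And>b. b \<in> B \<Longrightarrow> 0 < b"
    and AB: "\<And>a \<delta>. a \<in> A \<Longrightarrow> 0 < \<delta> \<Longrightarrow> a + \<delta> \<in> B"
    and BA: "\<And>b \<delta>. b \<in> B \<Longrightarrow> 0 < \<delta> \<Longrightarrow> b + \<delta> \<in> A"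
  shows "Inf A = Inf B"
proof (rule antisym)
  have bdd: "bdd_below A" "bdd_below B"
    using assms(2,3) by (auto intro!: bdd_belowI[of _ 0] less_imp_le)
  have "B \<noteq> {}"
    using assms(1) AB[OF _ zero_less_one] by blast
  then show "Inf A \<le> Inf B"
    using bdd BA by (intro Inf_le_if_shifts_subset) auto
  show "Inf B \<le> Inf A"
    using bdd AB assms(1) by (intro Inf_le_if_shifts_subset) auto
qed

theorem theorem3p6:
  fixes Y Z :: "'x :: complex_banach set"
  assumes "compact (UNIV :: 'k :: t2_space set)"
    and "csubspace Y" and "closed Y"
    and "csubspace Z" and "closed Z"
  shows "kadison_kastler_dist Y Z =
      kadison_kastler_dist (Y \<otimes>\<^sub>\<epsilon> (UNIV :: ('k \<Rightarrow>\<^sub>C complex) set)) (Z \<otimes>\<^sub>\<epsilon> UNIV) \<and>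
    christensen_dist Y Z =
      christensen_dist (Y \<otimes>\<^sub>\<epsilon> (UNIV :: ('k \<Rightarrow>\<^sub>C complex) set)) (Z \<otimes>\<^sub>\<epsilon> UNIV)"
proof
  have zero: "0 \<in> Y" "0 \<in> Z" "0 \<in> unit_ball Y" "0 \<in> unit_ball Z"
    using assms(2,4) by (auto simp: complex_vector.subspace_0 unit_ball_def)
  note up = near_inclusion_tensor[OF assms(1)] and down = near_inclusion_of_tensor[where 'k = 'k]
  show "kadison_kastler_dist Y Z =
      kadison_kastler_dist (Y \<otimes>\<^sub>\<epsilon> (UNIV :: ('k \<Rightarrow>\<^sub>C complex) set)) (Z \<otimes>\<^sub>\<epsilon> UNIV)"
    unfolding kadison_kastler_dist_eq_Inf[OF zero(1,2)]
      kadison_kastler_dist_eq_Inf[OF zero_in_injective_tensor zero_in_injective_tensor]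
  proof (rule Inf_eq_if_shifts_subset)
    show "{\<gamma>. 0 < \<gamma> \<and> near_inclusion Y \<gamma> (unit_ball Z) \<and> near_inclusion Z \<gamma> (unit_ball Y)} \<noteq> {}"
      using zero by (auto intro!: exI[of _ 1] near_inclusion_one)
  qed (use assms(2,4) in \<open>auto intro: up(2) down(2)\<close>)
  show "christensen_dist Y Z =
      christensen_dist (Y \<otimes>\<^sub>\<epsilon> (UNIV :: ('k \<Rightarrow>\<^sub>C complex) set)) (Z \<otimes>\<^sub>\<epsilon> UNIV)"
    unfolding christensen_dist_def
  proof (rule Inf_eq_if_shifts_subset)
    show "{\<gamma>. 0 < \<gamma> \<and> near_inclusion Y \<gamma> Z \<and> near_inclusion Z \<gamma> Y} \<noteq> {}"
      using zero by (auto intro!: exI[of _ 1] near_inclusion_one)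
  qed (use assms(2,4) in \<open>auto intro: up(1) down(1)\<close>)
qed

end
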